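(* Let $f_0,\dots,f_m\colon\{-1,1\}^n\to\{-1,1\}$ and $g_0,\dots,g_n\colon\{-1,1\}^m\to\{-1,1\}$ satisfy, for all $z\in\{-1,1\}^{[n]\times[m]}$, $f_0(g_1(z_{1\cdot}),\dots,g_n(z_{n\cdot}))=g_0(f_1(z_{\cdot1}),\dots,f_m(z_{\cdot m}))$, where $z_{i\cdot}=(z_{i1},\dots,z_{im})$, $z_{\cdot j}=(z_{1j},\dots,z_{nj})$. Suppose all of $f_0,\dots,f_m,g_0,\dots,g_n$ have degree at least $2$ and $f_0,g_0$ depend on all their inputs. Then there exist a set $Z_0\subseteq[n]\times[m]$, a partition $Z_0=Z_1\sqcup\dots\sqcup Z_k$ whose parts are pairwise disjoint in rows and in columns, a function $h\colon\{-1,1\}^k\to\{-1,1\}$, and for every $\ell\in[k]$ functions $f_0^{(\ell)}\colon\{-1,1\}^{\mathrm{rows}(Z_\ell)}\to\{-1,1\}$, $g_0^{(\ell)}\colon\{-1,1\}^{\mathrm{cols}(Z_\ell)}\to\{-1,1\}$, such that $f_0(x)=h(f_0^{(1)}(x|_{\mathrm{rows}(Z_1)}),\dots,f_0^{(k)}(x|_{\mathrm{rows}(Z_k)}))$ and $g_0(y)=h(g_0^{(1)}(y|_{\mathrm{cols}(Z_1)}),\dots,g_0^{(k)}(y|_{\mathrm{cols}(Z_k)}))$, and for every $\ell\in[k]$ one of the following holds: (1) for all $i\in\mathrm{rows}(Z_\ell)$, $j\in\mathrm{cols}(Z_\ell)$: $g_i(y)=C_i\prod_{j'\in\mathrm{Dep}(g_i)}y_{j'}$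 and $f_j(x)=A_j\prod_{i'\in\mathrm{Dep}(f_j)}x_{i'}$ with $C_i,A_j\in\{-1,1\}$, and $f_0^{(\ell)}(x)=\prod_{i\in\mathrm{rows}(Z_\ell)}x_i/C_i$, $g_0^{(\ell)}(y)=\prod_{j\in\mathrm{cols}(Z_\ell)}y_j/A_j$; (2) there are $D_i,B_j\in\{-1,1\}$ ($i\in\mathrm{rows}(Z_\ell)$, $j\in\mathrm{cols}(Z_\ell)$) and $\kappa_{ij}\in\{-1,1\}$ such that for all $i\in\mathrm{rows}(Z_\ell)$, $j\in\mathrm{cols}(Z_\ell)$: $g_i(y)=2D_i\prod_{j'\in\mathrm{Dep}(g_i)}\frac{\kappa_{ij'}y_{j'}+1}{2}-D_i$ and $f_j(x)=2B_j\prod_{i'\in\mathrm{Dep}(f_j)}\frac{\kappa_{i'j}x_{i'}+1}{2}-B_j$, and $f_0^{(\ell)}(x)=2\prod_{i\in\mathrm{rows}(Z_\ell)}\frac{D_ix_i+1}{2}-1$, $g_0^{(\ell)}(y)=2\prod_{j\in\mathrm{cols}(Z_\ell)}\frac{B_jy_j+1}{2}-1$.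
   Context: Boolean values are encoded as $\pm1$. Every $f\colon\{-1,1\}^n\to\mathbb R$ is identified with its unique multilinear expansion $f(x)=\sum_{S\subseteq[n]}\hat f(S)\prod_{i\in S}x_i$, and $\deg f$ is the degree of this polynomial; $\mathrm{Dep}(f)$ is the set of coordinates on which $f$ depends. For $W\subseteq[n]\times[m]$, $\mathrm{rows}(W)$ and $\mathrm{cols}(W)$ are the projections of $W$ onto the first and second coordinate; $x|_R$ denotes the restriction of $x$ to the coordinates in $R$. *)

theory Defs
  imports Complex_Main "HOL-Library.FuncSet" "HOL-Library.Disjoint_Sets"
begin

text \<open>Points of \<open>{-1,1}\<^sup>I\<close> are extensional functions on \<open>I\<close>; functions on the cube are functions
  on \<^typ>\<open>'i \<Rightarrow> real\<close>, of which only the values on the cube matter.\<close>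

abbreviation pm1 :: "real set" where
  "pm1 \<equiv> {-1, 1}"

definition cube :: "'i set \<Rightarrow> ('i \<Rightarrow> real) set" where
  "cube I = I \<rightarrow>\<^sub>E pm1"

definition multilinear_expansion ::
    "'i set \<Rightarrow> (('i \<Rightarrow> real) \<Rightarrow> real) \<Rightarrow> ('i set \<Rightarrow> real) \<Rightarrow> bool" where
  "multilinear_expansion I f c \<longleftrightarrow>
     (\<forall>S. \<not> S \<subseteq> I \<longrightarrow> c S = 0) \<and>
     (\<forall>x \<in> cube I. f x = (\<Sum>S \<in> Pow I. c S * (\<Prod>i\<in>S. x i)))"

definition fourier :: "'i set \<Rightarrow> (('i \<Rightarrow> real) \<Rightarrow> real) \<Rightarrow> 'i set \<Rightarrow> real" where
  "fourier I f = (THE c. multilinear_expansion I f c)"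

text \<open>The inserted \<open>0\<close> only matters for the zero function, which gets degree \<open>0\<close>.\<close>

definition deg :: "'i set \<Rightarrow> (('i \<Rightarrow> real) \<Rightarrow> real) \<Rightarrow> nat" where
  "deg I f = Max (insert 0 (card ` {S. S \<subseteq> I \<and> fourier I f S \<noteq> 0}))"

definition Dep :: "'i set \<Rightarrow> (('i \<Rightarrow> real) \<Rightarrow> real) \<Rightarrow> 'i set" where
  "Dep I f = {i \<in> I. \<exists>x \<in> cube I. f (x(i := - x i)) \<noteq> f x}"

abbreviation rows :: "('a \<times> 'b) set \<Rightarrow> 'a set" where
  "rows W \<equiv> fst ` W"

abbreviation cols :: "('a \<times> 'b) set \<Rightarrow> 'b set" where
  "cols W \<equiv> snd ` W"

lemma finite_cube: "finite I \<Longrightarrow> finite (cube I)"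
  unfolding cube_def by (rule finite_PiE) auto

lemma cube_nth: "x \<in> cube I \<Longrightarrow> i \<in> I \<Longrightarrow> x i = -1 \<or> x i = 1"
  unfolding cube_def by (auto dest: PiE_mem)

lemma kernel_cube:
  assumes "finite I" "x \<in> cube I" "y \<in> cube I"
  shows "(\<Prod>i\<in>I. 1 + x i * y i) = (if x = y then 2 ^ card I else 0)"
proof (cases "x = y")
  case True
  have "(\<Prod>i\<in>I. 1 + x i * y i) = (\<Prod>i\<in>I. 2)"
    by (rule prod.cong) (use True cube_nth[OF assms(2)] in fastforce)+
  then show ?thesis using True by simp
next
  case False
  have "\<exists>i\<in>I. x i \<noteq> y i"
    using False assms(2,3) unfolding cube_def by (metis PiE_ext)
  then obtain i where i: "i \<in> I" "x i \<noteq> y i" by blast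
  have "1 + x i * y i = 0"
    using i cube_nth[OF assms(2) i(1)] cube_nth[OF assms(3) i(1)] by auto
  then have "(\<Prod>i\<in>I. 1 + x i * y i) = 0"
    using assms(1) i(1) by (meson prod_zero)
  then show ?thesis using False by simp
qed

lemma prod_one_plus_Pow:
  fixes a :: "'i \<Rightarrow> real"
  assumes "finite I"
  shows "(\<Prod>i\<in>I. 1 + a i) = (\<Sum>S\<in>Pow I. \<Prod>i\<in>S. a i)"
  using prod_add[OF assms, of a "\<lambda>_. 1"] by (simp add: add.commute)

lemma cube_orthogonal:
  assumes I: "finite I" and S: "S \<subseteq> I" and T: "T \<subseteq> I"
  shows "(\<Sum>x\<in>cube I. (\<Prod>i\<in>S. x i) * (\<Prod>i\<in>T. x i)) = (if S = T then 2 ^ card I else 0)"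
proof -
  let ?p = "\<lambda>i v. (if i \<in> S then v else 1) * (if i \<in> T then v else (1::real))"
  have r: "(\<Prod>i\<in>U. x i) = (\<Prod>i\<in>I. if i \<in> U then x i else 1)" if "U \<subseteq> I" for U and x :: "'a \<Rightarrow> real"
    using prod.inter_restrict[OF I, of x U] that by (simp add: Int_absorb1)
  have "(\<Sum>x\<in>cube I. (\<Prod>i\<in>S. x i) * (\<Prod>i\<in>T. x i)) = (\<Sum>x\<in>I \<rightarrow>\<^sub>E pm1. \<Prod>i\<in>I. ?p i (x i))"
    unfolding cube_def by (simp add: r[OF S] r[OF T] prod.distrib)
  also have "\<dots> = (\<Prod>i\<in>I. \<Sum>v\<in>pm1. ?p i v)"
    by (rule prod_sum_PiE[symmetric]) (use I in auto)
  also have "\<dots> = (\<Prod>i\<in>I. if i \<in> S \<longleftrightarrow> i \<in> T then 2 else 0)"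
    by (rule prod.cong) auto
  also have "\<dots> = (if S = T then 2 ^ card I else 0)"
  proof (cases "S = T")
    case False
    then obtain i where "i \<in> I" "(i \<in> S) \<noteq> (i \<in> T)" using S T by blast
    then show ?thesis using False I by (auto intro!: prod_zero)
  qed simp
  finally show ?thesis .
qed

lemma multilinear_expansion_fourier_formula:
  assumes I: "finite I"
  shows "multilinear_expansion I f
    (\<lambda>S. if S \<subseteq> I then (\<Sum>y\<in>cube I. f y * (\<Prod>i\<in>S. y i)) / 2 ^ card I else 0)"
  unfolding multilinear_expansion_def
proof (intro conjI allI impI ballI)
  fix x assume x: "x \<in> cube I"
  have "(\<Sum>S\<in>Pow I. (if S \<subseteq> I then (\<Sum>y\<in>cube I. f y * (\<Prod>i\<in>S. y i)) / 2 ^ card I else 0) * (\<Prod>i\<in>S. x i))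
      = (\<Sum>S\<in>Pow I. \<Sum>y\<in>cube I. f y * (\<Prod>i\<in>S. x i * y i) / 2 ^ card I)"
    by (rule sum.cong)
       (auto simp: sum_distrib_left sum_divide_distrib prod.distrib mult_ac intro!: sum.cong)
  also have "\<dots> = (\<Sum>y\<in>cube I. f y * (\<Sum>S\<in>Pow I. \<Prod>i\<in>S. x i * y i) / 2 ^ card I)"
    by (subst sum.swap) (simp add: sum_distrib_left sum_divide_distrib)
  also have "\<dots> = (\<Sum>y\<in>cube I. if x = y then f y else 0)"
    by (rule sum.cong) (simp_all add: prod_one_plus_Pow[OF I, symmetric] kernel_cube[OF I x])
  also have "\<dots> = f x" using x finite_cube[OF I] by simp
  finally show "f x = (\<Sum>S\<in>Pow I. (if S \<subseteq> I then (\<Sum>y\<in>cube I. f y * (\<Prod>i\<in>S. y i)) / 2 ^ card I else 0) * (\<Prod>i\<in>S. x i))"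
    by simp
qed auto

lemma multilinear_expansion_coeff:
  assumes I: "finite I" and c: "multilinear_expansion I f c"
  shows "c S = (if S \<subseteq> I then (\<Sum>y\<in>cube I. f y * (\<Prod>i\<in>S. y i)) / 2 ^ card I else 0)"
proof (cases "S \<subseteq> I")
  case True
  have "(\<Sum>y\<in>cube I. f y * (\<Prod>i\<in>S. y i))
      = (\<Sum>y\<in>cube I. \<Sum>T\<in>Pow I. c T * ((\<Prod>i\<in>T. y i) * (\<Prod>i\<in>S. y i)))"
    using c by (auto simp: multilinear_expansion_def sum_distrib_left mult_ac intro!: sum.cong)
  also have "\<dots> = (\<Sum>T\<in>Pow I. c T * (\<Sum>y\<in>cube I. (\<Prod>i\<in>T. y i) * (\<Prod>i\<in>S. y i)))"
    by (subst sum.swap) (simp add: sum_distrib_left)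
  also have "\<dots> = (\<Sum>T\<in>Pow I. if T = S then c T * 2 ^ card I else 0)"
    by (rule sum.cong) (use cube_orthogonal[OF I _ True] in auto)
  also have "\<dots> = c S * 2 ^ card I" using True I by simp
  finally show ?thesis using True by simp
qed (use c in \<open>simp add: multilinear_expansion_def\<close>)

lemma ex1_multilinear_expansion:
  assumes "finite I"
  shows "\<exists>!c. multilinear_expansion I f c"
  using multilinear_expansion_fourier_formula[OF assms] multilinear_expansion_coeff[OF assms]
  by (metis (no_types, lifting) ext)

lemma multilinear_expansion_fourier:
  "finite I \<Longrightarrow> multilinear_expansion I f (fourier I f)"
  unfolding fourier_def by (rule theI'[OF ex1_multilinear_expansion])

end

theory Submission
  imports Defs
begin

text \<open>
  Write \<open>Z\<^sub>0\<close> for the set of cells \<open>(i,j)\<close> on which the common composite depends, and \<open>D\<close> for discrete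
  derivatives. Differentiating the identity in \<open>z\<^sub>i\<^sub>j\<close> gives
  \<open>D\<^sub>i f\<^sub>0 \<cdot> D\<^sub>j g\<^sub>i = D\<^sub>j g\<^sub>0 \<cdot> D\<^sub>i f\<^sub>j\<close>, where the outer factor on the left ignores row \<open>i\<close> and the
  outer factor on the right ignores column \<open>j\<close>. Hence \<open>D\<^sub>i f\<^sub>0\<close> splits as \<open>D\<^sub>i f\<^sub>j\<close> (a function of column \<open>j\<close>)
  times a function of the cells outside row \<open>i\<close> and column \<open>j\<close>. Varying another row \<open>k\<close> that meets
  column \<open>j\<close>, this product is a function of the single bit \<open>g\<^sub>k\<close>, which forces \<open>g\<^sub>k\<close> either to change sign with
  \<open>z\<^sub>k\<^sub>j\<close> or to be canalized by \<open>z\<^sub>k\<^sub>j\<close> (constant once \<open>z\<^sub>k\<^sub>j\<close> has the wrong value). A row cannot mix the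
  two behaviours, so each \<open>g\<^sub>k\<close> is a parity or a conjunction of literals, and the kind agrees along rows
  and columns. The same factorization shows that two rows sharing a column enter \<open>f\<^sub>0\<close> only through
  their parity, respectively conjunction. The parts are therefore the connected components of
  \<open>Z\<^sub>0\<close>, and \<open>h\<close> is the composite evaluated on one representative for each vector of block values.
\<close>

section \<open>Discrete derivatives of Boolean functions\<close>

definition flip :: "'i \<Rightarrow> ('i \<Rightarrow> bool) \<Rightarrow> 'i \<Rightarrow> bool" where
  "flip i x = x(i := \<not> x i)"

definition dep :: "(('i \<Rightarrow> bool) \<Rightarrow> bool) \<Rightarrow> 'i set" where
  "dep f = {i. \<exists>x. f (flip i x) \<noteq> f x}"

text \<open>Boolean functions are total on \<open>'i \<Rightarrow> bool\<close>; that only the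
  coordinates in \<open>I\<close> matter is a separate property.\<close>

definition junta :: "'i set \<Rightarrow> (('i \<Rightarrow> bool) \<Rightarrow> bool) \<Rightarrow> bool" where
  "junta I f \<longleftrightarrow> (\<forall>x y. (\<forall>i\<in>I. x i = y i) \<longrightarrow> f x = f y)"

lemma juntaD: "junta I f \<Longrightarrow> (\<And>i. i \<in> I \<Longrightarrow> x i = y i) \<Longrightarrow> f x = f y"
  by (auto simp: junta_def)

definition sg :: "bool \<Rightarrow> real" where
  "sg b = (if b then 1 else -1)"

definition deriv_at :: "'i \<Rightarrow> (('i \<Rightarrow> bool) \<Rightarrow> bool) \<Rightarrow> ('i \<Rightarrow> bool) \<Rightarrow> real" where
  "deriv_at i f x = sg (f (x(i := True))) - sg (f (x(i := False)))"

text \<open>Over the two-element field this makes \<open>f\<close> the coordinate \<open>i\<close>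
  plus a function of the other coordinates.\<close>

definition linear_at :: "(('i \<Rightarrow> bool) \<Rightarrow> bool) \<Rightarrow> 'i \<Rightarrow> bool" where
  "linear_at f i \<longleftrightarrow> (\<forall>x. f (flip i x) = (\<not> f x))"

text \<open>Here \<open>\<kappa>\<close> is the literal and its negation the canalizing value; the
  output \<open>b\<close> can occur only when \<open>x i = \<kappa>\<close>.\<close>

definition forced_at :: "(('i \<Rightarrow> bool) \<Rightarrow> bool) \<Rightarrow> 'i \<Rightarrow> bool \<Rightarrow> bool \<Rightarrow> bool" where
  "forced_at f i \<kappa> b \<longleftrightarrow> (\<forall>x. x i \<noteq> \<kappa> \<longrightarrow> f x = (\<not> b))"

lemma linear_atD: "linear_at f i \<Longrightarrow> f (flip i x) = (\<not> f x)"
  unfolding linear_at_def by (erule spec)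

lemma forced_atD: "forced_at f i \<kappa> b \<Longrightarrow> x i \<noteq> \<kappa> \<Longrightarrow> f x = (\<not> b)"
  unfolding forced_at_def by (drule spec) (erule mp)

lemma sg_simps [simp]: "sg True = 1" "sg False = -1" "sg (\<not> b) = - sg b" "sg b * sg b = 1"
  "sg b \<noteq> 0" "sg a = sg b \<longleftrightarrow> a = b" "sg b = 1 \<longleftrightarrow> b" "sg b = -1 \<longleftrightarrow> \<not> b"
  by (auto simp: sg_def split: if_splits)

lemma sg_in_pm1: "sg b \<in> pm1"
  by (cases b) auto

lemma flip_flip [simp]: "flip i (flip i x) = x"
  by (auto simp: flip_def)

lemma flip_commute: "flip i (flip j x) = flip j (flip i x)"
  by (rule ext) (auto simp: flip_def)

lemma flip_same [simp]: "flip i x i = (\<not> x i)"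
  by (simp add: flip_def)

lemma flip_other [simp]: "j \<noteq> i \<Longrightarrow> flip i x j = x j"
  by (simp add: flip_def)

lemma not_dep_upd:
  assumes "i \<notin> dep f"
  shows "f (x(i := b)) = f x"
proof (cases "x i = b")
  case False
  then have "x(i := b) = flip i x" by (auto simp: flip_def)
  moreover have "f (flip i x) = f x" using assms unfolding dep_def by blast
  ultimately show ?thesis by (simp only:)
qed (simp add: fun_upd_idem)

lemma deriv_at_upd [simp]: "deriv_at i f (x(i := b)) = deriv_at i f x"
  by (simp add: deriv_at_def)

lemma deriv_at_cong:
  assumes "\<And>k. k \<noteq> i \<Longrightarrow> x k = y k"
  shows "deriv_at i f x = deriv_at i f y"
proof -
  have "x(i := b) = y(i := b)" for b using assms by (simp add: fun_eq_iff)
  then show ?thesis by (simp only: deriv_at_def)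
qed

lemma deriv_at_nonzero_iff: "deriv_at i f x \<noteq> 0 \<longleftrightarrow> f (flip i x) \<noteq> f x"
proof (cases "x i")
  case True
  then have "x(i := True) = x" "flip i x = x(i := False)" by (auto simp: flip_def fun_upd_idem)
  then show ?thesis by (auto simp: deriv_at_def)
next
  case False
  then have "x(i := False) = x" "flip i x = x(i := True)" by (auto simp: flip_def fun_upd_idem)
  then show ?thesis by (auto simp: deriv_at_def)
qed

lemma dep_iff_deriv_at: "i \<in> dep f \<longleftrightarrow> (\<exists>x. deriv_at i f x \<noteq> 0)"
  by (simp add: dep_def deriv_at_nonzero_iff)

lemma deriv_at_values: "deriv_at i f x = 0 \<or> deriv_at i f x = 2 \<or> deriv_at i f x = -2"
  by (auto simp: deriv_at_def sg_def)

text \<open>Discrete chain rule: a function of one bit is affine in its sign, so exchanging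
  \<open>q\<close> for \<open>p\<close> scales the derivative by half the difference of the
  signs.\<close>

lemma deriv_at_chain:
  "sg (f (x(i := p))) - sg (f (x(i := q))) = (sg p - sg q) / 2 * deriv_at i f x"
  by (cases p; cases q) (auto simp: deriv_at_def)

lemma deriv_at_not_dep: "k \<notin> dep f \<Longrightarrow> deriv_at i f (x(k := b)) = deriv_at i f x"
  by (cases "k = i") (simp, simp add: deriv_at_def fun_upd_twist[of k i] not_dep_upd)

text \<open>Pass from \<open>x\<close> to \<open>y\<close> by changing the finitely many coordinates
  of \<open>I\<close> one at a time: outside \<open>dep f\<close> a change has no effect, and inside
  \<open>dep f\<close> there is nothing to change.\<close>

lemma junta_dep:
  assumes "finite I" "junta I f"
  shows "junta (dep f) f"
  unfolding junta_def
proof (intro allI impI)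
  fix x y :: "'a \<Rightarrow> bool" assume xy: "\<forall>i\<in>dep f. x i = y i"
  have "f (\<lambda>i. if i \<in> A then y i else x i) = f x" if "finite A" for A
    using that
  proof (induction A)
    case (insert a A)
    let ?w = "\<lambda>i. if i \<in> A then y i else x i"
    have "(\<lambda>i. if i \<in> insert a A then y i else x i) = ?w(a := y a)" by (simp add: fun_eq_iff)
    moreover have "f (?w(a := y a)) = f ?w"
    proof (cases "a \<in> dep f")
      case True
      then have "?w a = y a" using xy by simp
      then show ?thesis by (intro arg_cong[where f = f] fun_upd_idem)
    qed (rule not_dep_upd)
    ultimately show ?case using insert.IH by (simp only:)
  qed simp
  from this[OF assms(1)] have "f x = f (\<lambda>i. if i \<in> I then y i else x i)" by simp
  also have "\<dots> = f y" by (rule juntaD[OF assms(2)]) simp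
  finally show "f x = f y" .
qed

lemma nonconstant_surj:
  assumes "i \<in> dep f"
  shows "\<exists>x. f x = b"
proof -
  obtain x where "f (flip i x) \<noteq> f x" using assms unfolding dep_def by blast
  then have "f (flip i x) = b \<or> f x = b" by auto
  then show ?thesis by blast
qed

text \<open>If both values of coordinate \<open>i\<close> were canalizing, \<open>f\<close> would be
  determined by that coordinate alone, against its dependence on \<open>k\<close>. The value
  \<open>b\<close> can then be read off at any point violating the literal.\<close>

lemma forced_at_unique:
  assumes "forced_at f i \<kappa> b" "forced_at f i \<kappa>' b'" "k \<in> dep f" "k \<noteq> i"
  shows "\<kappa> = \<kappa>'" "b = b'"
proof -
  show eq: "\<kappa> = \<kappa>'"
  proof (rule ccontr)
    assume ne: "\<kappa> \<noteq> \<kappa>'"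
    obtain x where "f (flip k x) \<noteq> f x" using assms(3) by (auto simp: dep_def)
    moreover have "flip k x i = x i" using assms(4) by simp
    moreover have "x i \<noteq> \<kappa> \<or> x i \<noteq> \<kappa>'" using ne by auto
    ultimately show False
      using assms(1,2)[unfolded forced_at_def, THEN spec[of _ x]]
        assms(1,2)[unfolded forced_at_def, THEN spec[of _ "flip k x"]] by auto
  qed
  show "b = b'"
    using assms(1,2)[unfolded forced_at_def, THEN spec[of _ "\<lambda>_. \<not> \<kappa>"]] eq by auto
qed

text \<open>Giving \<open>j\<close> the wrong value fixes \<open>f\<close>, while flipping
  \<open>i\<close> would still have to change it.\<close>

lemma linear_not_forced:
  assumes lin: "linear_at f i" and fc: "forced_at f j \<kappa> b" and ne: "j \<noteq> i"
  shows False
proof -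
  define x where "x = (\<lambda>_::'a. \<not> \<kappa>)"
  have "f x = (\<not> b)" by (rule forced_atD[OF fc]) (simp add: x_def)
  moreover have "f (flip i x) = (\<not> b)" by (rule forced_atD[OF fc]) (simp add: x_def ne)
  ultimately show False using linear_atD[OF lin, of x] by simp
qed

text \<open>Flipping \<open>j\<close> negates \<open>\<psi> (g y)\<close>. This is nonzero at
  \<open>y0\<close>, so both bits occur as \<open>g y0\<close> and \<open>g (flip j y0)\<close> and
  \<open>\<psi>\<close> vanishes at neither; every sign change of \<open>\<psi> (g y)\<close> is
  then a change of \<open>g\<close>.\<close>

lemma linear_of_product:
  fixes \<psi> e :: "bool \<Rightarrow> real"
  assumes prod: "\<And>y. \<psi> (g y) = e (y j) * a y"
    and a: "\<And>y b. a (y(j := b)) = a y"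
    and y0: "a y0 \<noteq> 0"
    and e: "e True = - e False" "e False \<noteq> 0"
  shows "linear_at g j"
proof -
  have e': "e (\<not> b) = - e b" "e b \<noteq> 0" for b using e by (cases b; simp)+
  have fl: "\<psi> (g (flip j y)) = - \<psi> (g y)" for y
    unfolding prod flip_def a using e' by simp
  have "\<psi> (g y0) \<noteq> 0" using prod y0 e' by simp
  moreover have "\<psi> (g (flip j y0)) \<noteq> \<psi> (g y0)" "\<psi> (g (flip j y0)) \<noteq> 0"
    using calculation fl[of y0] by linarith+
  ultimately have nz: "\<psi> b \<noteq> 0" for b
    by (cases b; cases "g y0"; cases "g (flip j y0)") simp_all
  show ?thesis unfolding linear_at_def
  proof
    fix x
    have "\<psi> (g (flip j x)) \<noteq> \<psi> (g x)" using fl[of x] nz[of "g x"] by linarith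
    then show "g (flip j x) = (\<not> g x)" by (cases "g x"; cases "g (flip j x)") auto
  qed
qed

text \<open>When \<open>y j\<close> is not \<open>\<kappa>\<close>, \<open>\<psi> (g y)\<close> is
  zero, whereas \<open>\<psi>\<close> is nonzero at the bit that \<open>g\<close> takes at
  \<open>y0(j := \<kappa>)\<close>; so \<open>g y\<close> must be the opposite bit.\<close>

lemma forced_of_product:
  fixes \<psi> e :: "bool \<Rightarrow> real"
  assumes prod: "\<And>y. \<psi> (g y) = e (y j) * a y"
    and a: "\<And>y b. a (y(j := b)) = a y"
    and y0: "a y0 \<noteq> 0"
    and e: "e \<kappa> \<noteq> 0" "e (\<not> \<kappa>) = 0"
  shows "\<exists>b. forced_at g j \<kappa> b"
proof -
  have nz: "\<psi> (g (y0(j := \<kappa>))) \<noteq> 0" unfolding prod a using y0 e by simp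
  have z: "\<psi> (g y) = 0" if "y j \<noteq> \<kappa>" for y
  proof -
    have "y j = (\<not> \<kappa>)" using that by auto
    then show ?thesis unfolding prod using e by simp
  qed
  have "g y \<noteq> g (y0(j := \<kappa>))" if "y j \<noteq> \<kappa>" for y
  proof
    assume "g y = g (y0(j := \<kappa>))"
    then show False using nz z[of y, OF that] by (simp only:)
  qed
  then have "forced_at g j \<kappa> (g (y0(j := \<kappa>)))" unfolding forced_at_def by blast
  then show ?thesis by blast
qed

section \<open>Parity and conjunction rows\<close>

text \<open>\<open>dep2_f\<close> and \<open>dep2_g\<close> say that every inner function depends on
  at least two coordinates, phrased so as to supply one different from a given coordinate.\<close>

locale commuting_pair =
  fixes f0 :: "('a \<Rightarrow> bool) \<Rightarrow> bool" and g0 :: "('b \<Rightarrow> bool) \<Rightarrow> bool"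
    and f :: "'b \<Rightarrow> ('a \<Rightarrow> bool) \<Rightarrow> bool" and g :: "'a \<Rightarrow> ('b \<Rightarrow> bool) \<Rightarrow> bool"
    and I :: "'a set" and J :: "'b set"
  assumes fin: "finite I" "finite J"
    and commute: "\<And>z. f0 (\<lambda>i. g i (z i)) = g0 (\<lambda>j. f j (\<lambda>i. z i j))"
    and junta_f0: "junta I f0" and junta_g0: "junta J g0"
    and junta_f: "\<And>j. j \<in> J \<Longrightarrow> junta I (f j)" and junta_g: "\<And>i. i \<in> I \<Longrightarrow> junta J (g i)"
    and dep_f0: "dep f0 = I" and dep_g0: "dep g0 = J"
    and dep2_f: "\<And>j i. j \<in> J \<Longrightarrow> \<exists>i'\<in>dep (f j). i' \<noteq> i"
    and dep2_g: "\<And>i j. i \<in> I \<Longrightarrow> \<exists>j'\<in>dep (g i). j' \<noteq> j"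
begin

text \<open>The hypotheses are symmetric under transposing \<open>z\<close>, so each statement about
  rows also holds for columns.\<close>

lemma swap: "commuting_pair g0 f0 g f J I"
proof
  show "g0 (\<lambda>i. f i (z i)) = f0 (\<lambda>j. g j (\<lambda>i. z i j))" for z
    using commute[of "\<lambda>i j. z j i"] by simp
qed (use fin junta_f0 junta_g0 junta_f junta_g dep_f0 dep_g0 dep2_f dep2_g in auto)

text \<open>The cell \<open>(i, j)\<close> enters the left side only through argument
  \<open>i\<close> of \<open>f0\<close> and the right side only through argument \<open>j\<close> of
  \<open>g0\<close>; the chain rule applies to both sides.\<close>

lemma deriv_commute:
  "deriv_at i f0 (\<lambda>k. g k (z k)) * deriv_at j (g i) (z i) =
   deriv_at j g0 (\<lambda>l. f l (\<lambda>k. z k l)) * deriv_at i (f j) (\<lambda>k. z k j)"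
proof -
  define w where "w b = z(i := (z i)(j := b))" for b
  have L: "(\<lambda>k. g k (w b k)) = (\<lambda>k. g k (z k))(i := g i ((z i)(j := b)))" for b
    by (auto simp: w_def)
  have R: "(\<lambda>l. f l (\<lambda>k. w b k l)) = (\<lambda>l. f l (\<lambda>k. z k l))(j := f j ((\<lambda>k. z k j)(i := b)))" for b
    by (rule ext) (auto simp: w_def fun_upd_def intro!: arg_cong[where f = "f _"])
  have "sg (f0 (\<lambda>k. g k (w True k))) - sg (f0 (\<lambda>k. g k (w False k))) =
        sg (g0 (\<lambda>l. f l (\<lambda>k. w True k l))) - sg (g0 (\<lambda>l. f l (\<lambda>k. w False k l)))"
    by (simp only: commute)
  then have "deriv_at j (g i) (z i) / 2 * deriv_at i f0 (\<lambda>k. g k (z k)) =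
    deriv_at i (f j) (\<lambda>k. z k j) / 2 * deriv_at j g0 (\<lambda>l. f l (\<lambda>k. z k l))"
    unfolding deriv_at_def[of j "g i"] deriv_at_def[of i "f j"] deriv_at_chain[symmetric] L R .
  then show ?thesis by (simp add: mult.commute)
qed

text \<open>Rows use disjoint sets of variables and each \<open>g i\<close> is nonconstant, so their
  outputs can be prescribed independently.\<close>

lemma realize: "\<exists>z. (\<forall>i\<in>I. g i (z i) = x i)"
proof -
  have "\<exists>y. g i y = x i" if "i \<in> I" for i
    using dep2_g[OF that] nonconstant_surj by metis
  then show ?thesis by metis
qed

lemma f0_cong: "(\<And>i. i \<in> I \<Longrightarrow> x i = y i) \<Longrightarrow> f0 x = f0 y"
  using junta_f0 unfolding junta_def by blast

lemma deriv_f0_cong: "(\<And>i. i \<in> I \<Longrightarrow> x i = y i) \<Longrightarrow> deriv_at k f0 x = deriv_at k f0 y"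
  unfolding deriv_at_def using f0_cong[of "x(k := True)" "y(k := True)"]
    f0_cong[of "x(k := False)" "y(k := False)"] by auto

text \<open>Both factors on the left of \<open>deriv_commute\<close> can be made nonzero at once,
  since the derivative of \<open>f0\<close> in direction \<open>i\<close> ignores the content of row
  \<open>i\<close>. Hence both factors on the right are nonzero.\<close>

lemma dep_g_imp_dep_f:
  assumes i: "i \<in> I" and j: "j \<in> dep (g i)"
  shows "j \<in> J" "i \<in> dep (f j)"
proof -
  obtain x where x: "deriv_at i f0 x \<noteq> 0" using i unfolding dep_f0[symmetric] dep_iff_deriv_at by blast
  obtain y where y: "deriv_at j (g i) y \<noteq> 0" using j unfolding dep_iff_deriv_at by blast
  obtain z where z: "\<And>i. i \<in> I \<Longrightarrow> g i (z i) = x i" using realize by metis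
  define w where "w = z(i := y)"
  have "deriv_at i f0 (\<lambda>k. g k (w k)) = deriv_at i f0 (\<lambda>k. g k (z k))"
    by (rule deriv_at_cong) (simp add: w_def)
  also have "\<dots> = deriv_at i f0 x" by (rule deriv_f0_cong) (rule z)
  finally have "deriv_at i f0 (\<lambda>k. g k (w k)) * deriv_at j (g i) (w i) \<noteq> 0"
    using x y by (simp add: w_def)
  then have nz: "deriv_at j g0 (\<lambda>l. f l (\<lambda>k. w k l)) \<noteq> 0" "deriv_at i (f j) (\<lambda>k. w k j) \<noteq> 0"
    unfolding deriv_commute[of i w j] by auto
  have "j \<in> dep g0" using nz(1) dep_iff_deriv_at[of j g0] by blast
  then show "j \<in> J" using dep_g0 by simp
  show "i \<in> dep (f j)" using nz(2) dep_iff_deriv_at[of i "f j"] by blast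
qed

lemma dep_f_imp_dep_g:
  assumes "j \<in> J" "i \<in> dep (f j)"
  shows "i \<in> I" "j \<in> dep (g i)"
  using commuting_pair.dep_g_imp_dep_f[OF swap assms] by auto

text \<open>Divide \<open>deriv_commute\<close> by the derivative of \<open>g i\<close>. With row
  \<open>i\<close> frozen, the quotient \<open>\<alpha>\<close> is insensitive to row
  \<open>i\<close>; it is insensitive to column \<open>j\<close> because a derivative in direction
  \<open>j\<close> ignores argument \<open>j\<close> of \<open>g0\<close>.\<close>

lemma factor_deriv_f0:
  assumes i: "i \<in> I" and j: "j \<in> dep (g i)"
  shows "\<exists>\<alpha>. (\<forall>z. deriv_at i f0 (\<lambda>k. g k (z k)) = deriv_at i (f j) (\<lambda>k. z k j) * \<alpha> z) \<and>
    (\<forall>z z'. (\<forall>k l. k \<noteq> i \<longrightarrow> l \<noteq> j \<longrightarrow> z k l = z' k l) \<longrightarrow> \<alpha> z = \<alpha> z') \<and>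
    (\<forall>u. \<exists>z. (\<lambda>k. z k j) = u \<and> \<alpha> z \<noteq> 0)"
proof -
  obtain y where y: "deriv_at j (g i) y \<noteq> 0" using j unfolding dep_iff_deriv_at by blast
  \<comment> \<open>Row \<open>i\<close> is frozen at \<open>y\<close>; this does not affect \<open>deriv_at i\<close>.\<close>
  define \<alpha> where "\<alpha> z = deriv_at j g0 (\<lambda>l. f l (\<lambda>k. (z(i := y)) k l)) / deriv_at j (g i) y"
    for z :: "'a \<Rightarrow> 'b \<Rightarrow> bool"
  have 1: "deriv_at i f0 (\<lambda>k. g k (z k)) = deriv_at i (f j) (\<lambda>k. z k j) * \<alpha> z" for z
  proof -
    have a: "deriv_at i f0 (\<lambda>k. g k ((z(i := y)) k)) = deriv_at i f0 (\<lambda>k. g k (z k))"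
      by (rule deriv_at_cong) auto
    have b: "deriv_at i (f j) (\<lambda>k. (z(i := y)) k j) = deriv_at i (f j) (\<lambda>k. z k j)"
      by (rule deriv_at_cong) auto
    show ?thesis using deriv_commute[of i "z(i := y)" j] y unfolding a b \<alpha>_def
      by (simp add: field_simps)
  qed
  have 2: "\<alpha> z = \<alpha> z'" if agree: "\<forall>k l. k \<noteq> i \<longrightarrow> l \<noteq> j \<longrightarrow> z k l = z' k l" for z z'
  proof -
    have "(\<lambda>k. (z(i := y)) k l) = (\<lambda>k. (z'(i := y)) k l)" if "l \<noteq> j" for l
      using agree that by auto
    then have "deriv_at j g0 (\<lambda>l. f l (\<lambda>k. (z(i := y)) k l)) = deriv_at j g0 (\<lambda>l. f l (\<lambda>k. (z'(i := y)) k l))"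
      by (intro deriv_at_cong) simp
    then show ?thesis by (simp add: \<alpha>_def)
  qed
  have 3: "\<exists>z. (\<lambda>k. z k j) = u \<and> \<alpha> z \<noteq> 0" for u
  proof -
    obtain x where x: "deriv_at i f0 x \<noteq> 0" using i unfolding dep_f0[symmetric] dep_iff_deriv_at by blast
    obtain z where z: "\<And>i. i \<in> I \<Longrightarrow> g i (z i) = x i" using realize by metis
    have "deriv_at i f0 (\<lambda>k. g k (z k)) = deriv_at i f0 x" by (rule deriv_f0_cong) (rule z)
    then have nz: "\<alpha> z \<noteq> 0" using x 1[of z] by auto
    \<comment> \<open>Overwriting column \<open>j\<close> by \<open>u\<close> does not change
      \<open>\<alpha>\<close>, so a nonzero value is compatible with every content of that
      column.\<close>
    let ?z = "\<lambda>k. (z k)(j := u k)"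
    have "\<alpha> ?z = \<alpha> z" by (rule 2) auto
    with nz show ?thesis by (intro exI[of _ ?z]) auto
  qed
  show ?thesis
    by (rule exI[of _ \<alpha>]) (intro conjI allI impI; (rule 1 | rule 2 | rule 3); assumption?)
qed

text \<open>Let only row \<open>k\<close> vary. The derivative of \<open>f0\<close> then depends on
  the row through the single bit \<open>g k y\<close>, and by the factorization it equals
  \<open>e (y j)\<close> times a term ignoring \<open>y j\<close>; the two product lemmas read off
  how \<open>g k\<close> behaves at \<open>j\<close>.\<close>

lemma derivative_pattern:
  assumes j: "j \<in> J" and i: "i \<in> dep (f j)" and ki: "k \<noteq> i"
    and e: "\<And>b. e b = deriv_at i (f j) (u(k := b))"
  shows "e True = - e False \<Longrightarrow> e False \<noteq> 0 \<Longrightarrow> linear_at (g k) j"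
    and "e \<kappa> \<noteq> 0 \<Longrightarrow> e (\<not> \<kappa>) = 0 \<Longrightarrow> \<exists>b. forced_at (g k) j \<kappa> b"
proof -
  obtain \<alpha> where fac: "\<forall>z. deriv_at i f0 (\<lambda>k. g k (z k)) = deriv_at i (f j) (\<lambda>k. z k j) * \<alpha> z"
    and ign: "\<forall>z z'. (\<forall>k l. k \<noteq> i \<longrightarrow> l \<noteq> j \<longrightarrow> z k l = z' k l) \<longrightarrow> \<alpha> z = \<alpha> z'"
    and nz: "\<forall>u. \<exists>z. (\<lambda>k. z k j) = u \<and> \<alpha> z \<noteq> 0"
    using factor_deriv_f0[OF dep_f_imp_dep_g[OF j i]] by (elim exE conjE) (rule that; assumption)
  obtain z where z: "(\<lambda>k. z k j) = u" "\<alpha> z \<noteq> 0" using nz by blast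
  define \<psi> where "\<psi> b = deriv_at i f0 ((\<lambda>k. g k (z k))(k := b))" for b
  define a where "a y = \<alpha> (z(k := y))" for y
  have prod: "\<psi> (g k y) = e (y j) * a y" for y
  proof -
    have "(\<lambda>k. g k (z k))(k := g k y) = (\<lambda>l. g l ((z(k := y)) l))" by auto
    moreover have "u(k := y j) = (\<lambda>l. (z(k := y)) l j)" using z(1) by auto
    ultimately show ?thesis
      unfolding \<psi>_def a_def e by (simp only: fac[THEN spec, of "z(k := y)"])
  qed
  have a: "a (y(j := b)) = a y" for y b
    unfolding a_def by (rule ign[rule_format]) auto
  have y0: "a (z k) \<noteq> 0" using z(2) by (simp add: a_def)
  show "e True = - e False \<Longrightarrow> e False \<noteq> 0 \<Longrightarrow> linear_at (g k) j"
    by (rule linear_of_product[of \<psi> "g k" e j a, OF prod a y0])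
  show "e \<kappa> \<noteq> 0 \<Longrightarrow> e (\<not> \<kappa>) = 0 \<Longrightarrow> \<exists>b. forced_at (g k) j \<kappa> b"
    by (rule forced_of_product[of \<psi> "g k" e j a, OF prod a y0])
qed

section \<open>A common support point for the derivatives of a column function\<close>

text \<open>An arbitrary bit when \<open>g i\<close> is not canalized by \<open>j\<close>.\<close>

definition canal :: "'a \<Rightarrow> 'b \<Rightarrow> bool" where
  "canal i j = (SOME \<kappa>. \<exists>b. forced_at (g i) j \<kappa> b)"

lemma canal_eq:
  assumes "i \<in> I" "forced_at (g i) j \<kappa> b"
  shows "canal i j = \<kappa>"
proof -
  have "\<exists>b. forced_at (g i) j (canal i j) b"
    unfolding canal_def by (rule someI_ex) (use assms(2) in blast)
  then show ?thesis using dep2_g[OF assms(1), of j] forced_at_unique(1)[OF _ assms(2)] by blast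
qed

text \<open>If a neighbour of a support point in direction \<open>k\<close> leaves the support, then \<open>g k\<close> is canalized at \<open>j\<close>
  and the point already has the canalizing value. So every \<open>deriv_at i (f j)\<close> is nonzero at the one point
  \<open>\<lambda>k. canal k j\<close>, which excludes multiplexer-like \<open>f j\<close>.\<close>

lemma deriv_support_upd:
  assumes j: "j \<in> J" and i: "i \<in> dep (f j)" and u: "deriv_at i (f j) u \<noteq> 0"
  shows "deriv_at i (f j) (u(k := canal k j)) \<noteq> 0"
proof (cases "k = i \<or> k \<notin> dep (f j)")
  case True
  then show ?thesis using u deriv_at_not_dep by fastforce
next
  case False
  then have ki: "k \<noteq> i" and k: "k \<in> I" "j \<in> dep (g k)" using dep_f_imp_dep_g[OF j] by auto
  define e where "e b = deriv_at i (f j) (u(k := b))" for b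
  show ?thesis
  proof (cases "e (\<not> u k) = 0")
    case True
    have "e (u k) \<noteq> 0" using u by (simp add: e_def)
    then obtain b where "forced_at (g k) j (u k) b"
      using derivative_pattern(2)[OF j i ki e_def _ True] by blast
    then have "canal k j = u k" using canal_eq k(1) by blast
    then show ?thesis using u by simp
  next
    case False
    then have "e b \<noteq> 0" for b
      using u by (cases "b = u k") (auto simp: e_def)
    then show ?thesis by (simp add: e_def)
  qed
qed

text \<open>Move from a support point to \<open>canal\<close> one coordinate at a time, staying in
  the support by \<open>deriv_support_upd\<close>; coordinates outside \<open>I\<close> are
  invisible to \<open>f j\<close>.\<close>

lemma deriv_at_canal:
  assumes j: "j \<in> J" and i: "i \<in> dep (f j)"
  shows "deriv_at i (f j) (\<lambda>k. canal k j) \<noteq> 0"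
proof -
  obtain u where u: "deriv_at i (f j) u \<noteq> 0" using i unfolding dep_iff_deriv_at by blast
  have "deriv_at i (f j) (\<lambda>k. if k \<in> A then canal k j else u k) \<noteq> 0" if "finite A" for A
    using that
  proof (induction A)
    case (insert a A)
    have "(\<lambda>k. if k \<in> insert a A then canal k j else u k) =
      (\<lambda>k. if k \<in> A then canal k j else u k)(a := canal a j)" by (simp add: fun_eq_iff)
    then show ?case using deriv_support_upd[OF j i insert.IH] by simp
  qed (use u in simp)
  from this[OF fin(1)] have "deriv_at i (f j) (\<lambda>k. if k \<in> I then canal k j else u k) \<noteq> 0" .
  moreover have "deriv_at i (f j) (\<lambda>k. if k \<in> I then canal k j else u k) = deriv_at i (f j) (\<lambda>k. canal k j)"
    unfolding deriv_at_def by (intro arg_cong2[where f = minus] arg_cong[where f = sg] juntaD[OF junta_f[OF j]]) auto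
  ultimately show ?thesis by simp
qed

text \<open>The point \<open>\<lambda>l. canal l j\<close> lies in the supports of the derivatives
  of \<open>f j\<close> in both directions \<open>i\<close> and \<open>k\<close>. This makes
  \<open>e\<close> nonconstant, and then the pattern of \<open>e\<close> decides the behaviour of
  \<open>g k\<close> at \<open>j\<close>.\<close>

lemma column_derivative:
  assumes k: "k \<in> I" and j: "j \<in> dep (g k)"
  obtains i e where "i \<noteq> k" "e = (\<lambda>b. deriv_at i (f j) ((\<lambda>l. canal l j)(k := b)))" "e True \<noteq> e False"
    "e True = - e False \<longrightarrow> linear_at (g k) j"
    "\<forall>\<kappa>. e (\<not> \<kappa>) = 0 \<longrightarrow> (\<exists>b. forced_at (g k) j \<kappa> b)"
proof -
  have jJ: "j \<in> J" and kj: "k \<in> dep (f j)" using dep_g_imp_dep_f[OF k j] by auto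
  obtain i where i: "i \<in> dep (f j)" "i \<noteq> k" using dep2_f[OF jJ] by blast
  define u where "u = (\<lambda>l. canal l j)"
  define e where "e = (\<lambda>b. deriv_at i (f j) (u(k := b)))"
  have ne: "e True \<noteq> e False"
  proof
    assume eq: "e True = e False"
    have "e (u k) \<noteq> 0" using deriv_at_canal[OF jJ i(1), folded u_def] by (simp add: e_def)
    with eq have "e True \<noteq> 0" "e False \<noteq> 0" by (cases "u k"; simp)+
    \<comment> \<open>A nonzero derivative determines both values of \<open>f j\<close> along
      direction \<open>i\<close>. Equal nonzero derivatives would make coordinate \<open>k\<close>
      ineffective at \<open>u\<close>.\<close>
    then have "f j (u(k := True, i := b)) = f j (u(k := False, i := b))" for b
      using eq by (cases b) (auto simp: e_def deriv_at_def sg_def split: if_splits)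
    from this[of "u i"] have "deriv_at k (f j) u = 0"
      using i(2) by (simp add: deriv_at_def fun_upd_twist[of k i] fun_upd_idem)
    then show False using deriv_at_canal[OF jJ kj, folded u_def] by simp
  qed
  have e: "e b = deriv_at i (f j) (u(k := b))" for b by (simp add: e_def)
  note pat = derivative_pattern[OF jJ i(1) i(2)[symmetric] e]
  have lin: "e True = - e False \<longrightarrow> linear_at (g k) j"
    using pat(1) ne by auto
  have "e \<kappa> \<noteq> 0" if "e (\<not> \<kappa>) = 0" for \<kappa>
    using that ne by (cases \<kappa>) auto
  then have fc: "\<forall>\<kappa>. e (\<not> \<kappa>) = 0 \<longrightarrow> (\<exists>b. forced_at (g k) j \<kappa> b)"
    using pat(2) by blast
  show ?thesis using that[OF i(2) e_def[unfolded u_def] ne lin fc] .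
qed

text \<open>A derivative takes only the values 0, 2 and -2, so two distinct ones are opposite or one
  of them is zero.\<close>

lemma linear_or_forced_g:
  assumes k: "k \<in> I" and j: "j \<in> dep (g k)"
  shows "linear_at (g k) j \<or> (\<exists>\<kappa> b. forced_at (g k) j \<kappa> b)"
proof -
  obtain i e where c: "i \<noteq> k" "e = (\<lambda>b. deriv_at i (f j) ((\<lambda>l. canal l j)(k := b)))" "e True \<noteq> e False"
    "e True = - e False \<longrightarrow> linear_at (g k) j"
    "\<forall>\<kappa>. e (\<not> \<kappa>) = 0 \<longrightarrow> (\<exists>b. forced_at (g k) j \<kappa> b)"
    by (rule column_derivative[OF k j]) (rule that; assumption)
  have v: "e b = 0 \<or> e b = 2 \<or> e b = -2" for b
    unfolding c(2) by (rule deriv_at_values)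
  have "e True = - e False \<or> e (\<not> False) = 0 \<or> e (\<not> True) = 0"
    using v[of True] v[of False] c(3) by (elim disjE) simp_all
  then show ?thesis
    using c(4) c(5)[THEN spec, of True] c(5)[THEN spec, of False] by blast
qed

text \<open>Flipping \<open>k\<close> negates \<open>f j\<close> and therefore its derivative in
  direction \<open>i\<close>, which is the linear pattern for \<open>e\<close>.\<close>

lemma linear_f_imp_linear_g:
  assumes k: "k \<in> I" and j: "j \<in> dep (g k)" and lin: "linear_at (f j) k"
  shows "linear_at (g k) j"
proof -
  obtain i e where c: "i \<noteq> k" "e = (\<lambda>b. deriv_at i (f j) ((\<lambda>l. canal l j)(k := b)))" "e True \<noteq> e False"
    "e True = - e False \<longrightarrow> linear_at (g k) j"
    "\<forall>\<kappa>. e (\<not> \<kappa>) = 0 \<longrightarrow> (\<exists>b. forced_at (g k) j \<kappa> b)"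
    by (rule column_derivative[OF k j]) (rule that; assumption)
  let ?u = "\<lambda>l. canal l j"
  have "f j (?u(k := True, i := b)) = (\<not> f j (?u(k := False, i := b)))" for b
  proof -
    have "?u(k := True, i := b) = flip k (?u(k := False, i := b))"
      using c(1) by (auto simp: flip_def fun_eq_iff)
    then show ?thesis using lin by (simp add: linear_at_def)
  qed
  then have "e True = - e False" unfolding c(2) by (simp add: deriv_at_def)
  with c(4) show ?thesis by simp
qed

text \<open>Once \<open>k\<close> has the wrong value \<open>f j\<close> is constant, so
  \<open>e\<close> vanishes there; the literal \<open>\<kappa>\<close> is inherited.\<close>

lemma forced_f_imp_forced_g:
  assumes k: "k \<in> I" and j: "j \<in> dep (g k)" and fc: "forced_at (f j) k \<kappa> b"
  shows "\<exists>b'. forced_at (g k) j \<kappa> b'"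
proof -
  obtain i e where c: "i \<noteq> k" "e = (\<lambda>b. deriv_at i (f j) ((\<lambda>l. canal l j)(k := b)))" "e True \<noteq> e False"
    "e True = - e False \<longrightarrow> linear_at (g k) j"
    "\<forall>\<kappa>. e (\<not> \<kappa>) = 0 \<longrightarrow> (\<exists>b. forced_at (g k) j \<kappa> b)"
    by (rule column_derivative[OF k j]) (rule that; assumption)
  let ?u = "\<lambda>l. canal l j"
  have "f j (?u(k := \<not> \<kappa>, i := b')) = (\<not> b)" for b'
    by (rule forced_atD[OF fc]) (use c(1) in simp)
  then have "e (\<not> \<kappa>) = 0" unfolding c(2) by (simp add: deriv_at_def)
  then show ?thesis using c(5) by blast
qed

section \<open>Every row is a parity or a conjunction\<close>

definition xor_row :: "'a \<Rightarrow> bool" where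
  "xor_row i \<longleftrightarrow> (\<forall>j\<in>dep (g i). linear_at (g i) j)"

text \<open>For a conjunction row the point \<open>canal i\<close> satisfies all literals, so this
  is the value taken when the conjunction holds.\<close>

definition row_value :: "'a \<Rightarrow> bool" where
  "row_value i = g i (canal i)"

text \<open>A relevant coordinate that is not linear is forced, and then
  \<open>linear_not_forced\<close> excludes linear coordinates elsewhere in the row. So all relevant
  coordinates are forced, with a common \<open>b\<close>, which must be the value at
  \<open>canal i\<close>.\<close>

lemma row_forced:
  assumes i: "i \<in> I" and nx: "\<not> xor_row i" and j: "j \<in> dep (g i)"
  shows "forced_at (g i) j (canal i j) (row_value i)"
proof -
  obtain j0 where j0: "j0 \<in> dep (g i)" "\<not> linear_at (g i) j0" using nx by (auto simp: xor_row_def)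
  then obtain \<kappa>0 b0 where fc0: "forced_at (g i) j0 \<kappa>0 b0" using linear_or_forced_g[OF i] by blast
  have ex: "forced_at (g i) j (canal i j) b0" if j: "j \<in> dep (g i)" for j
  proof -
    have "\<not> linear_at (g i) j"
      using j0(2) linear_not_forced[OF _ fc0, of j] by (cases "j0 = j") auto
    then obtain \<kappa> b where fc: "forced_at (g i) j \<kappa> b" using linear_or_forced_g[OF i j] by blast
    \<comment> \<open>When \<open>j\<close> and \<open>j0\<close> differ, both literals are violated
      at \<open>x\<close>, so the two forced outputs coincide.\<close>
    define x where "x = ((\<lambda>_. True)(j := \<not> \<kappa>))(j0 := \<not> \<kappa>0)"
    have "b = b0"
    proof (cases "j = j0")
      case True
      obtain l where "l \<in> dep (g i)" "l \<noteq> j" using dep2_g[OF i] by blast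
      with fc0 True show ?thesis using forced_at_unique(2)[OF fc, of \<kappa>0 b0 l] by simp
    next
      case False
      then have "x j \<noteq> \<kappa>" "x j0 \<noteq> \<kappa>0" by (auto simp: x_def)
      then show ?thesis using forced_atD[OF fc, of x] forced_atD[OF fc0, of x] by simp
    qed
    then show ?thesis using fc unfolding canal_eq[OF i fc] by simp
  qed
  \<comment> \<open>Otherwise \<open>g i\<close> would equal \<open>\<not> b0\<close> where all
    literals hold as well as where one fails, hence be constant.\<close>
  have "row_value i = b0"
  proof (rule ccontr)
    assume ne: "row_value i \<noteq> b0"
    have "g i y = (\<not> b0)" for y
    proof (cases "\<forall>j\<in>dep (g i). y j = canal i j")
      case True
      then have "g i y = g i (canal i)"
        by (intro juntaD[OF junta_dep[OF fin(2) junta_g[OF i]]]) blast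
      then show ?thesis using ne by (simp add: row_value_def)
    next
      case False
      then obtain l where "l \<in> dep (g i)" "y l \<noteq> canal i l" by blast
      then show ?thesis by (intro forced_atD[OF ex])
    qed
    then have "\<not> (\<exists>x. g i (flip j x) \<noteq> g i x)" by simp
    then show False using j unfolding dep_def by simp
  qed
  then show ?thesis using ex[OF j] by (simp only:)
qed

lemma and_row:
  assumes i: "i \<in> I" and nx: "\<not> xor_row i"
  shows "g i y = row_value i \<longleftrightarrow> (\<forall>j\<in>dep (g i). y j = canal i j)"
proof
  assume "g i y = row_value i"
  then show "\<forall>j\<in>dep (g i). y j = canal i j"
    using forced_atD[OF row_forced[OF assms]] by blast
next
  assume "\<forall>j\<in>dep (g i). y j = canal i j"
  then show "g i y = row_value i"
    unfolding row_value_def by (intro juntaD[OF junta_dep[OF fin(2) junta_g[OF i]]]) blast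
qed

end

text \<open>Start from the all-\<open>True\<close> point and set the relevant coordinates one by
  one; each \<open>False\<close> contributes one change of sign.\<close>

lemma xor_form:
  assumes R: "finite J" "junta J h" and lin: "\<And>j. j \<in> dep h \<Longrightarrow> linear_at h j" and sub: "dep h \<subseteq> J"
  shows "sg (h y) = sg (h (\<lambda>_. True)) * (\<Prod>j\<in>dep h. sg (y j))"
proof -
  have fin: "finite (dep h)" using R sub finite_subset by blast
  have ind: "sg (h (\<lambda>j. if j \<in> A then y j else True)) = sg (h (\<lambda>_. True)) * (\<Prod>j\<in>A. sg (y j))"
    if "finite A" "A \<subseteq> dep h" for A
    using that
  proof (induction A)
    case (insert a A)
    let ?w = "\<lambda>j. if j \<in> A then y j else True"
    have w: "(\<lambda>j. if j \<in> insert a A then y j else True) = (if y a then ?w else flip a ?w)"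
      using insert.hyps by (auto simp: flip_def fun_eq_iff)
    have "h (flip a ?w) = (\<not> h ?w)" using lin insert.prems by (auto simp: linear_at_def)
    then show ?case using insert unfolding w by (cases "y a") auto
  qed simp
  moreover have "h (\<lambda>j. if j \<in> dep h then y j else True) = h y"
    by (rule juntaD[OF junta_dep[OF R]]) simp
  ultimately show ?thesis using ind[OF fin order.refl] by simp
qed

section \<open>Two rows that share a column\<close>

context commuting_pair
begin

text \<open>Linearity passes from column to row at the cell \<open>(i, j)\<close>; a conjunction row
  would be forced at a second coordinate \<open>l\<close>, which a linear coordinate
  forbids.\<close>

lemma xor_col_imp_xor_row:
  assumes i: "i \<in> I" and j: "j \<in> dep (g i)" and x: "commuting_pair.xor_row f j"
  shows "xor_row i"
proof (rule ccontr)
  assume nx: "\<not> xor_row i"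
  have "linear_at (f j) i"
    using x dep_g_imp_dep_f[OF i j] unfolding commuting_pair.xor_row_def[OF swap] by blast
  then have lin: "linear_at (g i) j" by (rule linear_f_imp_linear_g[OF i j])
  obtain l where l: "l \<in> dep (g i)" "l \<noteq> j" using dep2_g[OF i] by blast
  show False by (rule linear_not_forced[OF lin row_forced[OF i nx l(1)] l(2)])
qed

text \<open>The factorization read at an arbitrary \<open>x\<close>: its entries are realized by the
  rows of some \<open>z\<close>, of which only row \<open>k\<close> then varies.\<close>

lemma slice_deriv_f0:
  assumes j: "j \<in> J" and i: "i \<in> dep (f j)" and ki: "k \<noteq> i"
  shows "\<exists>u a. (\<forall>y. deriv_at i f0 (x(k := g k y)) = deriv_at i (f j) (u(k := y j)) * a y) \<and>
    (\<forall>y b. a (y(j := b)) = a y)"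
proof -
  obtain \<alpha> where fac: "\<forall>z. deriv_at i f0 (\<lambda>k. g k (z k)) = deriv_at i (f j) (\<lambda>k. z k j) * \<alpha> z"
    and ign: "\<forall>z z'. (\<forall>k l. k \<noteq> i \<longrightarrow> l \<noteq> j \<longrightarrow> z k l = z' k l) \<longrightarrow> \<alpha> z = \<alpha> z'"
    using factor_deriv_f0[OF dep_f_imp_dep_g[OF j i]] by (elim exE conjE) (rule that; assumption)
  obtain z where z: "\<forall>i\<in>I. g i (z i) = x i" using realize by blast
  define u where "u = (\<lambda>k. z k j)"
  define a where "a y = \<alpha> (z(k := y))" for y
  have "deriv_at i f0 (x(k := g k y)) = deriv_at i (f j) (u(k := y j)) * a y" for y
  proof -
    have "deriv_at i f0 (x(k := g k y)) = deriv_at i f0 (\<lambda>l. g l ((z(k := y)) l))"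
      by (rule deriv_f0_cong) (simp add: z)
    moreover have "u(k := y j) = (\<lambda>l. (z(k := y)) l j)" by (auto simp: u_def)
    ultimately show ?thesis
      unfolding a_def by (simp only: fac[THEN spec, of "z(k := y)"])
  qed
  moreover have "a (y(j := b)) = a y" for y b
    unfolding a_def by (rule ign[rule_format]) auto
  ultimately show ?thesis by blast
qed

text \<open>Flipping \<open>y j\<close> changes the bit \<open>g k y\<close> and negates the
  derivative of \<open>f j\<close>, by linearity at this cell, while the remaining factor ignores
  \<open>y j\<close>.\<close>

lemma deriv_f0_odd:
  assumes j: "j \<in> J" and i: "i \<in> dep (f j)" and k: "k \<in> dep (f j)" and ki: "k \<noteq> i"
    and x: "commuting_pair.xor_row f j"
  shows "deriv_at i f0 (x(k := \<not> b)) = - deriv_at i f0 (x(k := b))"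
proof -
  note kj = dep_f_imp_dep_g[OF j k]
  have linf: "linear_at (f j) k"
    using x k unfolding commuting_pair.xor_row_def[OF swap] by blast
  have ling: "linear_at (g k) j" by (rule linear_f_imp_linear_g[OF kj linf])
  obtain u a where ua: "\<forall>y. deriv_at i f0 (x(k := g k y)) = deriv_at i (f j) (u(k := y j)) * a y"
    "\<forall>y b. a (y(j := b)) = a y"
    using slice_deriv_f0[OF j i ki] by blast
  obtain y where y: "g k y = b" using nonconstant_surj[OF kj(2)] by blast
  have "f j (u(k := \<not> c, i := d)) = (\<not> f j (u(k := c, i := d)))" for c d
  proof -
    have "u(k := \<not> c, i := d) = flip k (u(k := c, i := d))"
      using ki by (auto simp: flip_def fun_eq_iff)
    then show ?thesis using linear_atD[OF linf] by simp
  qed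
  then have e: "deriv_at i (f j) (u(k := \<not> c)) = - deriv_at i (f j) (u(k := c))" for c
    by (simp add: deriv_at_def)
  have gy: "g k (flip j y) = (\<not> b)" using linear_atD[OF ling] y by simp
  have ay: "a (flip j y) = a y" unfolding flip_def using ua(2) by blast
  have "deriv_at i f0 (x(k := g k (flip j y))) = deriv_at i (f j) (u(k := \<not> y j)) * a (flip j y)"
    using ua(1)[THEN spec, of "flip j y"] by simp
  also have "\<dots> = - (deriv_at i (f j) (u(k := y j)) * a y)" unfolding e ay by simp
  also have "\<dots> = - deriv_at i f0 (x(k := g k y))" using ua(1)[THEN spec, of y] by simp
  finally show ?thesis unfolding gy y .
qed

text \<open>On the square spanned by arguments \<open>i\<close> and \<open>k\<close>, each of the
  two derivatives of \<open>f0\<close> is odd in the other argument. Adding and subtracting these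
  relations shows that opposite corners carry the same value.\<close>

lemma xor_pair:
  assumes j: "j \<in> J" and i: "i \<in> dep (f j)" and k: "k \<in> dep (f j)"
    and x: "commuting_pair.xor_row f j"
  shows "f0 (flip i (flip k x)) = f0 x"
proof (cases "k = i")
  case False
  define p where "p a b = sg (f0 (x(i := a, k := b)))" for a b
  have 1: "p True True - p False True = - (p True False - p False False)"
    using deriv_f0_odd[OF j i k False x, of x False] False
    by (simp add: p_def deriv_at_def fun_upd_twist[of k i])
  have 2: "p True True - p True False = - (p False True - p False False)"
    using deriv_f0_odd[OF j k i False[symmetric] x, of x False]
    by (simp add: p_def deriv_at_def)
  have "p (\<not> a) (\<not> b) = p a b" for a b
    using 1 2 by (cases a; cases b) simp_all
  from this[of "x i" "x k"] have "f0 (x(i := \<not> x i, k := \<not> x k)) = f0 (x(i := x i, k := x k))"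
    unfolding p_def by (simp only: sg_simps)
  moreover have "flip i (flip k x) = x(i := \<not> x i, k := \<not> x k)"
    using False by (auto simp: flip_def fun_eq_iff)
  ultimately show ?thesis by simp
qed simp

interpretation dual: commuting_pair g0 f0 g f J I
  by (rule swap)

lemma xor_row_iff_col:
  assumes i: "i \<in> I" and j: "j \<in> dep (g i)"
  shows "xor_row i \<longleftrightarrow> dual.xor_row j"
  using xor_col_imp_xor_row[OF i j] dual.xor_col_imp_xor_row[OF dep_g_imp_dep_f[OF i j]] by blast

text \<open>The literal at a cell is the same bit from its row and from its column, because
  \<open>forced_f_imp_forced_g\<close> preserves it and it is unique.\<close>

lemma canal_dual:
  assumes i: "i \<in> I" and j: "j \<in> dep (g i)" and nx: "\<not> xor_row i"
  shows "dual.canal j i = canal i j"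
proof -
  note d = dep_g_imp_dep_f[OF i j]
  have "forced_at (f j) i (dual.canal j i) (dual.row_value j)"
    using dual.row_forced[OF d(1) _ d(2)] nx xor_row_iff_col[OF i j] by blast
  then obtain b where "forced_at (g i) j (dual.canal j i) b"
    using forced_f_imp_forced_g[OF i j] by blast
  then show ?thesis by (rule canal_eq[OF i, symmetric])
qed

text \<open>The bit \<open>x k\<close> is attained by a row violating the literal at
  \<open>j\<close>. In column \<open>j\<close> this makes \<open>f j\<close> constant in direction
  \<open>i\<close>, so the derivative of \<open>f0\<close> vanishes.\<close>

lemma and_pair:
  assumes j: "j \<in> J" and i: "i \<in> dep (f j)" and k: "k \<in> dep (f j)" and ki: "k \<noteq> i"
    and nx: "\<not> xor_row k" and x: "x k \<noteq> row_value k"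
  shows "f0 (flip i x) = f0 x"
proof -
  note kj = dep_f_imp_dep_g[OF j k]
  have "\<not> dual.xor_row j" using nx xor_row_iff_col[OF kj] by simp
  then have fc: "forced_at (f j) k (canal k j) (dual.row_value j)"
    using dual.row_forced[OF j _ k] canal_dual[OF kj nx] by simp
  obtain u a where ua: "\<forall>y. deriv_at i f0 (x(k := g k y)) = deriv_at i (f j) (u(k := y j)) * a y"
    using slice_deriv_f0[OF j i ki] by blast
  define y where "y = (\<lambda>_::'b. \<not> canal k j)"
  have "g k y = (\<not> row_value k)"
    by (rule forced_atD[OF row_forced[OF kj(1) nx kj(2)]]) (simp add: y_def)
  then have "g k y = x k" using x by auto
  then have upd: "x(k := g k y) = x" by simp
  have "f j (u(k := y j, i := c)) = (\<not> dual.row_value j)" for c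
    by (rule forced_atD[OF fc]) (use ki in \<open>simp add: y_def\<close>)
  then have "deriv_at i (f j) (u(k := y j)) = 0" by (simp add: deriv_at_def)
  then have "deriv_at i f0 x = 0" using ua[THEN spec, of y] upd by simp
  then show ?thesis using deriv_at_nonzero_iff[of i f0 x] by blast
qed

section \<open>Connected components of the relevant cells\<close>

definition cells :: "('a \<times> 'b) set" where
  "cells = {(i, j). i \<in> I \<and> j \<in> dep (g i)}"

text \<open>With cells viewed as edges of a bipartite graph on rows and columns, this is its line
  graph with loops; \<open>adjacent\<^sup>*\<close> describes the components.\<close>

definition adjacent :: "(('a \<times> 'b) \<times> ('a \<times> 'b)) set" where
  "adjacent = {(c, c'). c \<in> cells \<and> c' \<in> cells \<and> (fst c = fst c' \<or> snd c = snd c')}"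

lemma mem_cells_dual: "(i, j) \<in> cells \<longleftrightarrow> j \<in> J \<and> i \<in> dep (f j)"
  unfolding cells_def using dep_g_imp_dep_f dep_f_imp_dep_g by blast

lemma xor_row_adjacent: "(c, c') \<in> adjacent\<^sup>* \<Longrightarrow> xor_row (fst c) = xor_row (fst c')"
proof (induction rule: rtrancl_induct)
  case (step c' c'')
  have "xor_row (fst c') = xor_row (fst c'')"
    using step(2) xor_row_iff_col by (cases c'; cases c'') (auto simp: adjacent_def cells_def)
  with step.IH show ?case by simp
qed simp

text \<open>Induction along a path: \<open>flip i\<close> is inserted twice, which splits the double
  flip into one covered by the induction hypothesis and one between rows sharing a column.\<close>

lemma xor_connected:
  assumes "(c, c') \<in> adjacent\<^sup>*" and x: "xor_row (fst c)"
  shows "f0 (flip (fst c) (flip (fst c') x)) = f0 x"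
  using assms(1)
proof (induction arbitrary: x)
  case (step c' c'')
  obtain i j i' j' where c: "c' = (i, j)" "c'' = (i', j')" by (cases c'; cases c'')
  have mem: "(i, j) \<in> cells" "(i', j') \<in> cells" "i = i' \<or> j = j'"
    using step(2) c by (auto simp: adjacent_def)
  have xi: "xor_row i" using xor_row_adjacent[OF step(1)] x c by simp
  have edge: "f0 (flip i (flip i' x)) = f0 x"
  proof (cases "i = i'")
    case False
    then have j: "j \<in> J" "i \<in> dep (f j)" "i' \<in> dep (f j)" using mem mem_cells_dual by auto
    have "dual.xor_row j" using xi xor_row_iff_col mem(1) by (auto simp: cells_def)
    then show ?thesis by (rule xor_pair[OF j])
  qed simp
  have "f0 (flip (fst c) (flip i (flip i (flip i' x)))) = f0 (flip i (flip i' x))"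
    using step.IH[of "flip i (flip i' x)"] unfolding c fst_conv .
  then show ?case unfolding c flip_flip fst_conv edge .
qed simp

text \<open>Induction along a path. A violated row \<open>i'\<close> makes its neighbour
  \<open>i\<close> ineffective, so \<open>i\<close> may be taken as violated too, and the induction
  hypothesis applies with \<open>i\<close> in place of \<open>i'\<close>.\<close>

lemma and_connected:
  assumes "(c, c') \<in> adjacent\<^sup>*" and nx: "\<not> xor_row (fst c)"
    and "fst c \<noteq> fst c'" "x (fst c') \<noteq> row_value (fst c')"
  shows "f0 (flip (fst c) x) = f0 x"
  using assms(1,3,4)
proof (induction arbitrary: x)
  case (step c' c'')
  obtain i j i' j' where c: "c' = (i, j)" "c'' = (i', j')" by (cases c'; cases c'')
  have mem: "(i, j) \<in> cells" "(i', j') \<in> cells" "i = i' \<or> j = j'"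
    using step(2) c by (auto simp: adjacent_def)
  have ni: "\<not> xor_row i'" using xor_row_adjacent[OF rtrancl_into_rtrancl[OF step(1,2)]] nx c by simp
  define k where "k = fst c"
  have ki': "k \<noteq> i'" using step.prems c by (simp add: k_def)
  have IH: "f0 (flip k w) = f0 w" if "k \<noteq> i" "w i \<noteq> row_value i" for w
    unfolding k_def by (rule step.IH) (use that c in \<open>simp_all add: k_def\<close>)
  show ?case
  proof (cases "i = i'")
    case True
    then show ?thesis using IH[of x] step.prems c ki' by (simp add: k_def)
  next
    case ne: False
    then have j: "j \<in> J" "i \<in> dep (f j)" "i' \<in> dep (f j)" using mem mem_cells_dual by auto
    have edge: "f0 (flip i w) = f0 w" if "w i' \<noteq> row_value i'" for w
      by (rule and_pair[OF j _ ni]) (use ne that in simp_all)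
    have xi': "x i' \<noteq> row_value i'" using step.prems c by simp
    consider "k = i" | "k \<noteq> i" "x i \<noteq> row_value i" | "k \<noteq> i" "x i = row_value i" by blast
    then show ?thesis
    proof cases
      case 1
      then show ?thesis using edge[of x, OF xi'] by (simp only: k_def)
    next
      case 2
      then show ?thesis using IH[of x] by (simp add: k_def)
    next
      case 3
      \<comment> \<open>Row \<open>i\<close> is flipped to its wrong value, which is harmless
        because \<open>i'\<close> is violated; this enables the induction hypothesis, after which
        the flip is undone.\<close>
      have "f0 (flip k x) = f0 (flip i (flip k x))"
        by (rule edge[symmetric]) (use ki' xi' in simp)
      also have "\<dots> = f0 (flip k (flip i x))" by (simp only: flip_commute)
      also have "\<dots> = f0 (flip i x)" by (rule IH) (use 3 in auto)
      also have "\<dots> = f0 x" by (rule edge[of x, OF xi'])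
      finally show ?thesis by (simp add: k_def)
    qed
  qed
qed simp

end

section \<open>Block values\<close>

text \<open>The common shape of the inner functions of the decomposition, with \<open>b\<close>
  supplying the sign constants: a parity relative to \<open>b\<close>, or the conjunction saying
  that \<open>x\<close> agrees with \<open>b\<close> on \<open>R\<close>.\<close>

definition block_value :: "bool \<Rightarrow> ('i \<Rightarrow> bool) \<Rightarrow> 'i set \<Rightarrow> ('i \<Rightarrow> bool) \<Rightarrow> real" where
  "block_value t b R x = (if t then \<Prod>i\<in>R. sg (x i) * sg (b i) else sg (\<forall>i\<in>R. x i = b i))"

lemma block_value_cong:
  assumes "\<And>i. i \<in> R \<Longrightarrow> x i = y i"
  shows "block_value t b R x = block_value t b R y"
  unfolding block_value_def using assms by (simp cong: prod.cong)

lemma block_value_sg: "\<exists>c. block_value t b R x = sg c"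
proof (cases t)
  case True
  have "\<exists>c. (\<Prod>i\<in>R. sg (x i) * sg (b i)) = sg c"
  proof (induction R rule: infinite_finite_induct)
    case (insert a R)
    then obtain c where "(\<Prod>i\<in>R. sg (x i) * sg (b i)) = sg c" by blast
    then have "(\<Prod>i\<in>insert a R. sg (x i) * sg (b i)) = sg ((x a = b a) = c)"
      using insert.hyps by (cases "x a"; cases "b a"; cases c) simp_all
    then show ?case by blast
  qed (use sg_simps(1) in \<open>auto intro: exI[of _ True]\<close>)
  then show ?thesis using True by (simp add: block_value_def)
qed (auto simp: block_value_def)

lemma block_value_eq_iff: "block_value t b R x = block_value t' b' R' x' \<longleftrightarrow>
    (block_value t b R x = 1 \<longleftrightarrow> block_value t' b' R' x' = 1)"
proof -
  obtain c c' where "block_value t b R x = sg c" "block_value t' b' R' x' = sg c'"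
    using block_value_sg[of t b R x] block_value_sg[of t' b' R' x'] by blast
  then show ?thesis by simp
qed

lemma block_value_flip_other:
  assumes "i \<notin> R"
  shows "block_value t b R (flip i x) = block_value t b R x"
proof (rule block_value_cong)
  fix k assume "k \<in> R"
  then have "k \<noteq> i" using assms by auto
  then show "flip i x k = x k" by simp
qed

lemma block_value_flip:
  assumes "finite R" "i \<in> R"
  shows "block_value True b R (flip i x) = - block_value True b R x"
proof -
  have "(\<Prod>k\<in>R - {i}. sg (flip i x k) * sg (b k)) = (\<Prod>k\<in>R - {i}. sg (x k) * sg (b k))"
    by (rule prod.cong) auto
  then show ?thesis
    unfolding block_value_def using prod.remove[OF assms, of "\<lambda>k. sg (flip i x k) * sg (b k)"]
      prod.remove[OF assms, of "\<lambda>k. sg (x k) * sg (b k)"] by simp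
qed

text \<open>Induction on the number of coordinates of \<open>I\<close> where \<open>x\<close> and
  \<open>y\<close> differ. In a parity block two differing coordinates are flipped together; in a
  conjunction block one coordinate is flipped while another stays violated. Both moves keep
  \<open>f0\<close> and all block values.\<close>

lemma determined_by_block_values:
  assumes fin: "finite I" and jun: "junta I f0"
    and sub: "\<And>l. l \<in> L \<Longrightarrow> R l \<subseteq> I" and cover: "\<And>i. i \<in> I \<Longrightarrow> \<exists>l\<in>L. i \<in> R l"
    and disj: "\<And>l l'. l \<in> L \<Longrightarrow> l' \<in> L \<Longrightarrow> l \<noteq> l' \<Longrightarrow> R l \<inter> R l' = {}"
    and xor: "\<And>l i k x. l \<in> L \<Longrightarrow> T l \<Longrightarrow> i \<in> R l \<Longrightarrow> k \<in> R l \<Longrightarrow> f0 (flip i (flip k x)) = f0 x"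
    and conj: "\<And>l i k x. l \<in> L \<Longrightarrow> \<not> T l \<Longrightarrow> i \<in> R l \<Longrightarrow> k \<in> R l \<Longrightarrow> i \<noteq> k \<Longrightarrow>
      x k \<noteq> b k \<Longrightarrow> f0 (flip i x) = f0 x"
    and val: "\<forall>l\<in>L. block_value (T l) b (R l) x = block_value (T l) b (R l) y"
  shows "f0 x = f0 y"
  using val
proof (induction "card {i \<in> I. x i \<noteq> y i}" arbitrary: x y rule: less_induct)
  case less
  have finI: "finite {i \<in> I. x i \<noteq> y i}" for x y :: "'a \<Rightarrow> bool" using fin by simp
  show ?case
  proof (cases "{i \<in> I. x i \<noteq> y i} = {}")
    case True
    then show ?thesis by (intro juntaD[OF jun]) blast
  next
    case False
    then obtain i where i: "i \<in> I" "x i \<noteq> y i" by blast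
    obtain l where l: "l \<in> L" "i \<in> R l" using cover[OF i(1)] by blast
    have finR: "finite (R l)" using finite_subset[OF sub[OF l(1)] fin] .
    have other: "i \<notin> R l'" if "i \<in> R l" "l' \<in> L" "l' \<noteq> l" for i l'
      using disj[OF l(1) that(2)] that by auto
    have val_l: "block_value (T l) b (R l) x = block_value (T l) b (R l) y" using less.prems l by blast
    show ?thesis
    proof (cases "T l")
      case True
      \<comment> \<open>A single disagreement inside the block would make the two parities
        opposite.\<close>
      have "\<exists>k\<in>R l. k \<noteq> i \<and> x k \<noteq> y k"
      proof (rule ccontr)
        assume none: "\<not> ?thesis"
        have "block_value True b (R l) (flip i x) = block_value True b (R l) y"
        proof (rule block_value_cong)
          fix k assume "k \<in> R l"
          then show "flip i x k = y k" using none i(2) by (cases "k = i") auto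
        qed
        then have "- block_value True b (R l) x = block_value True b (R l) x"
          using block_value_flip[OF finR l(2), of b x] val_l True by simp
        moreover obtain c where "block_value True b (R l) x = sg c" using block_value_sg by blast
        ultimately show False by simp
      qed
      then obtain k where k: "k \<in> R l" "k \<noteq> i" "x k \<noteq> y k" by blast
      define x' where "x' = flip i (flip k x)"
      have f0x': "f0 x' = f0 x" unfolding x'_def by (rule xor[OF l(1) True l(2) k(1)])
      have "{i \<in> I. x' i \<noteq> y i} \<subset> {i \<in> I. x i \<noteq> y i}"
      proof
        show "{i \<in> I. x' i \<noteq> y i} \<subseteq> {i \<in> I. x i \<noteq> y i}"
          unfolding x'_def using i k by (auto simp: flip_def split: if_splits)
        have "x' i = y i" unfolding x'_def using i k by (auto simp: flip_def)
        then show "{i \<in> I. x' i \<noteq> y i} \<noteq> {i \<in> I. x i \<noteq> y i}" using i by blast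
      qed
      then have "card {i \<in> I. x' i \<noteq> y i} < card {i \<in> I. x i \<noteq> y i}" by (rule psubset_card_mono[OF finI])
      moreover have "\<forall>l\<in>L. block_value (T l) b (R l) x' = block_value (T l) b (R l) y"
      proof
        fix l' assume l': "l' \<in> L"
        have "block_value (T l') b (R l') x' = block_value (T l') b (R l') x"
        proof (cases "l' = l")
          case True
          then show ?thesis unfolding x'_def using \<open>T l\<close> block_value_flip[OF finR] l(2) k(1) by simp
        next
          case False
          then show ?thesis unfolding x'_def
            using other[OF l(2) l' False] other[OF k(1) l' False] by (simp add: block_value_flip_other)
        qed
        then show "block_value (T l') b (R l') x' = block_value (T l') b (R l') y"
          using less.prems l' by simp
      qed
      ultimately have "f0 x' = f0 y" by (rule less.hyps)
      then show ?thesis using f0x' by simp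
    next
      case False
      have iff: "(\<forall>i\<in>R l. x i = b i) \<longleftrightarrow> (\<forall>i\<in>R l. y i = b i)"
        using val_l False by (simp add: block_value_def)
      then have nx: "\<exists>k\<in>R l. x k \<noteq> b k" and ny: "\<exists>k\<in>R l. y k \<noteq> b k" using i(2) l(2) by blast+
      have step: "f0 (flip i w) = f0 w \<and>
          (\<forall>l\<in>L. block_value (T l) b (R l) (flip i w) = block_value (T l) b (R l) w)"
        if w: "\<exists>k\<in>R l. w k \<noteq> b k" "w i = b i" for w
      proof -
        obtain k where k: "k \<in> R l" "w k \<noteq> b k" using w by blast
        then have ki: "i \<noteq> k" using w(2) by auto
        have "block_value (T l') b (R l') (flip i w) = block_value (T l') b (R l') w" if l': "l' \<in> L" for l'
        proof (cases "l' = l")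
          case True
          have "flip i w k \<noteq> b k" using k ki by simp
          then have "(\<forall>k\<in>R l. flip i w k = b k) = (\<forall>k\<in>R l. w k = b k)" using k by blast
          then show ?thesis using True False by (simp only: block_value_def if_False)
        qed (use other[OF l(2) l'] in \<open>simp add: block_value_flip_other\<close>)
        then show ?thesis using conj[OF l(1) False l(2) k(1) ki, of w, OF k(2)] by blast
      qed
      have sub1: "{k \<in> I. flip i x k \<noteq> y k} \<subset> {i \<in> I. x i \<noteq> y i}"
          "{k \<in> I. x k \<noteq> flip i y k} \<subset> {i \<in> I. x i \<noteq> y i}"
        using i by (auto simp: flip_def split: if_splits)
      \<comment> \<open>Exactly one of the two points has the right value at \<open>i\<close>. That
        point is moved to the wrong value, which brings it closer to the other one.\<close>
      consider "x i = b i" | "y i = b i" using i(2) by auto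
      then show ?thesis
      proof cases
        case 1
        note s = step[OF nx 1]
        have "f0 (flip i x) = f0 y"
          by (rule less.hyps) (use psubset_card_mono[OF finI sub1(1)] s less.prems in simp_all)
        then show ?thesis using s by simp
      next
        case 2
        note s = step[OF ny 2]
        have "f0 x = f0 (flip i y)"
          by (rule less.hyps) (use psubset_card_mono[OF finI sub1(2)] s less.prems in simp_all)
        then show ?thesis using s by simp
      qed
    qed
  qed
qed

lemma block_value_reindex:
  "inj_on s P \<Longrightarrow> block_value t b (s ` P) x = block_value t (b \<circ> s) P (x \<circ> s)"
  unfolding block_value_def by (simp add: prod.reindex)

lemma block_value_cong_base:
  assumes "\<And>i. i \<in> R \<Longrightarrow> b i = b' i"
  shows "block_value t b R x = block_value t b' R x"
  unfolding block_value_def using assms by (simp cong: prod.cong)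

text \<open>One cell per block suffices to prescribe the block value: all other cells sit at their
  base value, and the root \<open>r\<close> does so exactly when \<open>\<beta>\<close>
  holds.\<close>

lemma block_value_root:
  assumes "finite P" "r \<in> P" and w: "\<And>c. c \<in> P \<Longrightarrow> w c = (b c = (c = r \<longrightarrow> \<beta>))"
  shows "block_value t b P w = sg \<beta>"
proof (cases t)
  case True
  have "(\<Prod>c\<in>P - {r}. sg (w c) * sg (b c)) = 1"
    by (rule prod.neutral) (use w in auto)
  moreover have "sg (w r) * sg (b r) = sg \<beta>" using w[OF assms(2)] by (cases "b r"; cases \<beta>) auto
  ultimately show ?thesis
    unfolding block_value_def using True prod.remove[OF assms(1,2), of "\<lambda>c. sg (w c) * sg (b c)"] by simp
next
  case False
  have "(\<forall>c\<in>P. w c = b c) \<longleftrightarrow> \<beta>" using w assms(2) by auto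
  then show ?thesis using False by (simp add: block_value_def)
qed


section \<open>Blocks of cells and their values\<close>

context commuting_pair
begin

text \<open>\<open>adjacent\<^sup>*\<close> is reflexive everywhere, so it is restricted to
  \<open>cells\<close> to be an equivalence relation on them.\<close>

definition same_block :: "(('a \<times> 'b) \<times> ('a \<times> 'b)) set" where
  "same_block = {(c, c'). c \<in> cells \<and> c' \<in> cells \<and> (c, c') \<in> adjacent\<^sup>*}"

definition blocks :: "('a \<times> 'b) set set" where
  "blocks = cells // same_block"

text \<open>The value of row \<open>i\<close> when its relevant cells all equal
  \<open>cell_base\<close>; its sign becomes the constant \<open>C i\<close> or
  \<open>D i\<close>.\<close>

definition row_base :: "'a \<Rightarrow> bool" where
  "row_base i = (if xor_row i then g i (\<lambda>_. True) else row_value i)"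

text \<open>For parity rows the base is \<open>True\<close>, the neutral sign in a product; for
  conjunction rows it is the literal.\<close>

definition cell_base :: "'a \<times> 'b \<Rightarrow> bool" where
  "cell_base c = (xor_row (fst c) \<or> canal (fst c) (snd c))"

lemma cells_subset: "cells \<subseteq> I \<times> J"
  unfolding cells_def using dep_g_imp_dep_f(1) by auto

lemma finite_cells: "finite cells"
  by (rule finite_subset[OF cells_subset]) (use fin in simp)

lemma sym_adjacent: "sym adjacent"
  unfolding sym_def adjacent_def by auto

lemma equiv_same_block: "equiv cells same_block"
proof (rule equivI)
  show "sym same_block"
  proof (rule symI)
    fix c c' assume "(c, c') \<in> same_block"
    then show "(c', c) \<in> same_block"
      using symD[OF sym_rtrancl[OF sym_adjacent], of c c'] unfolding same_block_def by simp
  qed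
  show "trans same_block"
  proof (rule transI)
    fix c c' c'' assume "(c, c') \<in> same_block" "(c', c'') \<in> same_block"
    then show "(c, c'') \<in> same_block"
      using rtrancl_trans[of c c' adjacent c''] unfolding same_block_def by simp
  qed
qed (auto simp: same_block_def refl_on_def)

lemma block_subset: "P \<in> blocks \<Longrightarrow> P \<subseteq> cells"
  unfolding blocks_def by (rule in_quotient_imp_subset[OF equiv_same_block])

lemma block_nonempty: "P \<in> blocks \<Longrightarrow> P \<noteq> {}"
  unfolding blocks_def by (rule in_quotient_imp_non_empty[OF equiv_same_block])

lemma block_connected: "P \<in> blocks \<Longrightarrow> c \<in> P \<Longrightarrow> c' \<in> P \<Longrightarrow> (c, c') \<in> adjacent\<^sup>*"
  using in_quotient_imp_in_rel[OF equiv_same_block, of P c c'] unfolding blocks_def same_block_def by auto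

lemma block_closed:
  assumes "P \<in> blocks" "c \<in> P" "(c, c') \<in> adjacent"
  shows "c' \<in> P"
proof -
  have "(c, c') \<in> same_block" using assms(3) unfolding same_block_def adjacent_def by auto
  then show ?thesis
    using in_quotient_imp_closed[OF equiv_same_block, of P c c'] assms(1,2) unfolding blocks_def by simp
qed

lemma blocks_eqI:
  assumes "P \<in> blocks" "P' \<in> blocks" "c \<in> P" "c' \<in> P'" "fst c = fst c' \<or> snd c = snd c'"
  shows "P = P'"
proof -
  have "c \<in> cells" "c' \<in> cells" using assms(3,4) block_subset[OF assms(1)] block_subset[OF assms(2)] by auto
  then have "(c, c') \<in> adjacent" using assms(5) unfolding adjacent_def by simp
  then have "c' \<in> P" by (rule block_closed[OF assms(1,3)])
  then show ?thesis
    using quotient_disj[OF equiv_same_block, of P P'] assms(1,2,4) unfolding blocks_def by auto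
qed

lemma block_index_unique:
  assumes bij: "bij_betw Z L blocks"
    and "l \<in> L" "l' \<in> L" "c \<in> Z l" "c' \<in> Z l'" "fst c = fst c' \<or> snd c = snd c'"
  shows "l = l'"
proof (rule inj_onD[OF bij_betw_imp_inj_on[OF bij] _ assms(2,3)])
  show "Z l = Z l'"
    using blocks_eqI[OF bij_betw_apply[OF bij assms(2)] bij_betw_apply[OF bij assms(3)] assms(4-6)] .
qed

lemma disjoint_rows_cols:
  assumes bij: "bij_betw Z L blocks"
  shows "disjoint_family_on (\<lambda>l. rows (Z l)) L" and "disjoint_family_on (\<lambda>l. cols (Z l)) L"
proof -
  show "disjoint_family_on (\<lambda>l. rows (Z l)) L"
    unfolding disjoint_family_on_def
  proof (intro ballI impI equals0I)
    fix l l' i assume l: "l \<in> L" "l' \<in> L" "l \<noteq> l'" and "i \<in> rows (Z l) \<inter> rows (Z l')"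
    then obtain c c' where "c \<in> Z l" "c' \<in> Z l'" "fst c = fst c'" by auto
    then show False using block_index_unique[OF bij l(1,2), of c c'] l(3) by simp
  qed
  show "disjoint_family_on (\<lambda>l. cols (Z l)) L"
    unfolding disjoint_family_on_def
  proof (intro ballI impI equals0I)
    fix l l' i assume l: "l \<in> L" "l' \<in> L" "l \<noteq> l'" and "i \<in> cols (Z l) \<inter> cols (Z l')"
    then obtain c c' where "c \<in> Z l" "c' \<in> Z l'" "snd c = snd c'" by auto
    then show False using block_index_unique[OF bij l(1,2), of c c'] l(3) by simp
  qed
qed

text \<open>Cells in the same row are adjacent, so a block that meets a row contains all relevant
  cells of that row.\<close>

lemma block_row_Sigma:
  assumes P: "P \<in> blocks"
  shows "P = Sigma (rows P) (\<lambda>i. dep (g i))"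
proof
  show "P \<subseteq> Sigma (rows P) (\<lambda>i. dep (g i))"
  proof
    fix c assume c: "c \<in> P"
    then have "snd c \<in> dep (g (fst c))" using block_subset[OF P] unfolding cells_def by auto
    moreover have "fst c \<in> rows P" using c by (rule imageI)
    ultimately show "c \<in> Sigma (rows P) (\<lambda>i. dep (g i))" by (simp add: mem_Sigma_iff[of "fst c" "snd c", simplified])
  qed
  show "Sigma (rows P) (\<lambda>i. dep (g i)) \<subseteq> P"
  proof
    fix c assume "c \<in> Sigma (rows P) (\<lambda>i. dep (g i))"
    then obtain i j j' where c: "c = (i, j)" "(i, j') \<in> P" "j \<in> dep (g i)" by auto
    have "((i, j'), c) \<in> adjacent"
      using c block_subset[OF P] unfolding adjacent_def cells_def by auto
    then show "c \<in> P" using block_closed[OF P c(2)] by blast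
  qed
qed

lemma block_col_Sigma:
  assumes P: "P \<in> blocks"
  shows "prod.swap ` P = Sigma (cols P) (\<lambda>j. dep (f j))"
proof
  show "prod.swap ` P \<subseteq> Sigma (cols P) (\<lambda>j. dep (f j))"
  proof
    fix c assume "c \<in> prod.swap ` P"
    then obtain i j where ij: "(i, j) \<in> P" "c = (j, i)" by auto
    then have "i \<in> dep (f j)" using block_subset[OF P] mem_cells_dual[of i j] by blast
    moreover have "j \<in> cols P" using image_eqI[of j snd "(i, j)" P] ij(1) by simp
    ultimately show "c \<in> Sigma (cols P) (\<lambda>j. dep (f j))" using ij(2) by simp
  qed
  show "Sigma (cols P) (\<lambda>j. dep (f j)) \<subseteq> prod.swap ` P"
  proof
    fix c assume "c \<in> Sigma (cols P) (\<lambda>j. dep (f j))"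
    then obtain i j i' where c: "c = (j, i)" "(i', j) \<in> P" "i \<in> dep (f j)" by auto
    have "(i', j) \<in> cells" using c block_subset[OF P] by blast
    then have "((i', j), (i, j)) \<in> adjacent"
      using c mem_cells_dual unfolding adjacent_def by auto
    then have "(i, j) \<in> P" using block_closed[OF P c(2)] by blast
    then show "c \<in> prod.swap ` P" using c(1) image_eqI[of c prod.swap "(i, j)" P] by simp
  qed
qed

text \<open>A parity of parities is a parity over all cells, and a conjunction of conjunctions is a
  conjunction over all cells; relative to the base values no constants remain.\<close>

lemma block_value_rows:
  assumes R: "R \<subseteq> I" and t: "\<And>i. i \<in> R \<Longrightarrow> xor_row i = t"
  shows "block_value t row_base R (\<lambda>i. g i (z i)) =
    block_value t cell_base (Sigma R (\<lambda>i. dep (g i))) (\<lambda>c. z (fst c) (snd c))"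
proof (cases t)
  case True
  have fR: "finite R" using R fin finite_subset by blast
  have sub: "dep (g i) \<subseteq> J" if "i \<in> R" for i using dep_g_imp_dep_f R that by blast
  then have fd: "\<forall>i\<in>R. finite (dep (g i))" using fin finite_subset by blast
  have "sg (g i (z i)) * sg (row_base i) = (\<Prod>j\<in>dep (g i). sg (z i j) * sg (cell_base (i, j)))"
    if i: "i \<in> R" for i
  proof -
    have x: "xor_row i" using t[OF i] True by simp
    have "sg (g i (z i)) = sg (g i (\<lambda>_. True)) * (\<Prod>j\<in>dep (g i). sg (z i j))"
      by (rule xor_form[OF fin(2) junta_g]) (use i R x sub in \<open>auto simp: xor_row_def\<close>)
    then show ?thesis using x by (simp add: row_base_def cell_base_def mult.assoc mult.left_commute)
  qed
  then have "(\<Prod>i\<in>R. sg (g i (z i)) * sg (row_base i)) =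
      (\<Prod>i\<in>R. \<Prod>j\<in>dep (g i). sg (z i j) * sg (cell_base (i, j)))" by (rule prod.cong[OF refl])
  also have "\<dots> = (\<Prod>(i, j)\<in>Sigma R (\<lambda>i. dep (g i)). sg (z i j) * sg (cell_base (i, j)))"
    by (rule prod.Sigma[OF fR fd])
  finally show ?thesis using True by (simp add: block_value_def case_prod_unfold)
next
  case False
  have "g i (z i) = row_base i \<longleftrightarrow> (\<forall>j\<in>dep (g i). z i j = cell_base (i, j))" if "i \<in> R" for i
    using and_row[of i "z i"] that R t[OF that] False by (auto simp: row_base_def cell_base_def)
  then have "(\<forall>i\<in>R. g i (z i) = row_base i) \<longleftrightarrow>
      (\<forall>c\<in>Sigma R (\<lambda>i. dep (g i)). z (fst c) (snd c) = cell_base c)" by auto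
  then show ?thesis using False by (simp only: block_value_def if_False)
qed

end

section \<open>The common outer function\<close>

context commuting_pair
begin

interpretation dual: commuting_pair g0 f0 g f J I
  by (rule swap)

lemma dual_cells: "(j, i) \<in> dual.cells \<longleftrightarrow> (i, j) \<in> cells"
  unfolding mem_cells_dual dual.cells_def by simp

lemma adjacent_dual:
  assumes "(c, c') \<in> adjacent\<^sup>*"
  shows "(prod.swap c, prod.swap c') \<in> dual.adjacent\<^sup>*"
  using assms
proof induction
  case (step c' c'')
  have "(prod.swap c', prod.swap c'') \<in> dual.adjacent"
    using step(2) dual_cells by (cases c'; cases c'') (auto simp: adjacent_def dual.adjacent_def)
  with step.IH show ?case by (rule rtrancl_into_rtrancl)
qed simp

lemma block_types:
  assumes P: "P \<in> blocks" and r: "r \<in> P"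
  shows "i \<in> rows P \<Longrightarrow> i \<in> I \<and> xor_row i = xor_row (fst r)"
    and "j \<in> cols P \<Longrightarrow> j \<in> J \<and> dual.xor_row j = xor_row (fst r)"
proof -
  have row: "i \<in> I \<and> j \<in> dep (g i) \<and> xor_row i = xor_row (fst r)" if "(i, j) \<in> P" for i j
    using xor_row_adjacent[OF block_connected[OF P that r]] that block_subset[OF P]
    by (auto simp: cells_def)
  show "i \<in> rows P \<Longrightarrow> i \<in> I \<and> xor_row i = xor_row (fst r)" using row by force
  assume "j \<in> cols P"
  then obtain i where "(i, j) \<in> P" by force
  then show "j \<in> J \<and> dual.xor_row j = xor_row (fst r)"
    using row xor_row_iff_col dep_g_imp_dep_f by blast
qed

text \<open>The row statement for the transposed pair, carried back along \<open>prod.swap\<close>.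
  Rows and columns of a block thus compute the same value from \<open>z\<close>, which is why one
  outer function serves both sides.\<close>

lemma block_value_cols:
  assumes P: "P \<in> blocks" and r: "r \<in> P"
  shows "block_value (xor_row (fst r)) dual.row_base (cols P) (\<lambda>j. f j (\<lambda>i. z i j)) =
    block_value (xor_row (fst r)) cell_base P (\<lambda>c. z (fst c) (snd c))"
proof -
  let ?t = "xor_row (fst r)"
  have "block_value ?t dual.row_base (cols P) (\<lambda>j. f j (\<lambda>i. z i j)) =
      block_value ?t dual.cell_base (prod.swap ` P) (\<lambda>c. z (snd c) (fst c))"
    unfolding block_col_Sigma[OF P]
    by (rule dual.block_value_rows) (use block_types(2)[OF P r] in auto)
  also have "\<dots> = block_value ?t (dual.cell_base \<circ> prod.swap) P (\<lambda>c. z (fst c) (snd c))"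
    by (subst block_value_reindex) (auto simp: comp_def inj_on_def)
  also have "\<dots> = block_value ?t cell_base P (\<lambda>c. z (fst c) (snd c))"
  proof (rule block_value_cong_base)
    fix c assume c: "c \<in> P"
    then obtain i j where ij: "c = (i, j)" "i \<in> I" "j \<in> dep (g i)"
      using block_subset[OF P] by (auto simp: cells_def)
    show "(dual.cell_base \<circ> prod.swap) c = cell_base c"
      using xor_row_iff_col[OF ij(2,3)] canal_dual[OF ij(2,3)] ij(1)
      by (auto simp: cell_base_def dual.cell_base_def)
  qed
  finally show ?thesis .
qed

text \<open>\<open>H\<close> evaluates the common composite on a matrix with block values
  \<open>\<beta>\<close>. By \<open>determined_by_block_values\<close>, \<open>f0\<close> and
  \<open>g0\<close> take the same value on the row or column outputs of that matrix as on any
  argument with these block values.\<close>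

lemma decomposition:
  fixes Z :: "nat \<Rightarrow> ('a \<times> 'b) set"
  assumes bij: "bij_betw Z L blocks" and root: "\<And>l. l \<in> L \<Longrightarrow> r l \<in> Z l"
  shows "\<exists>H. (\<forall>\<beta> \<beta>'. (\<forall>l\<in>L. \<beta> l = \<beta>' l) \<longrightarrow> H \<beta> = H \<beta>') \<and>
    (\<forall>x. f0 x = H (\<lambda>l. block_value (xor_row (fst (r l))) row_base (rows (Z l)) x = 1)) \<and>
    (\<forall>y. g0 y = H (\<lambda>l. block_value (xor_row (fst (r l))) dual.row_base (cols (Z l)) y = 1))"
proof -
  define T where "T l = xor_row (fst (r l))" for l
  \<comment> \<open>All cells are at their base value, except that a root \<open>r l\<close> is
    negated when \<open>\<beta> l\<close> is false.\<close>
  define z where "z \<beta> i j = (cell_base (i, j) = (\<forall>l\<in>L. (i, j) = r l \<longrightarrow> \<beta> l))" for \<beta> i j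
  define H where "H \<beta> = f0 (\<lambda>i. g i (z \<beta> i))" for \<beta>
  have Zb: "Z l \<in> blocks" if "l \<in> L" for l using bij_betw_apply[OF bij that] .
  note Zeq = block_index_unique[OF bij]
  have ex: "\<exists>l\<in>L. c \<in> Z l" if "c \<in> cells" for c
  proof -
    have "same_block `` {c} \<in> blocks" unfolding blocks_def using that by (rule quotientI)
    then have "same_block `` {c} \<in> Z ` L" unfolding bij_betw_imp_surj_on[OF bij] .
    then obtain l where l: "same_block `` {c} = Z l" "l \<in> L" by (rule imageE)
    have "c \<in> same_block `` {c}" using that unfolding same_block_def by auto
    then show ?thesis using l by auto
  qed
  have types: "i \<in> rows (Z l) \<Longrightarrow> i \<in> I \<and> xor_row i = T l" "j \<in> cols (Z l) \<Longrightarrow> j \<in> J \<and> dual.xor_row j = T l"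
    if "l \<in> L" for l i j
    unfolding T_def by (erule block_types[OF Zb[OF that] root[OF that]])+
  have cellval: "block_value (T l) cell_base (Z l) (\<lambda>c. z \<beta> (fst c) (snd c)) = sg (\<beta> l)" if l: "l \<in> L" for l \<beta>
  proof (rule block_value_root)
    show "finite (Z l)" by (rule finite_subset[OF block_subset[OF Zb[OF l]] finite_cells])
    show "r l \<in> Z l" using root[OF l] .
    fix c assume c: "c \<in> Z l"
    have uniq: "l' = l" if "l' \<in> L" "c = r l'" for l'
      by (rule Zeq[OF that(1) l root[OF that(1)] c]) (use that(2) in simp)
    have "(\<forall>l'\<in>L. c = r l' \<longrightarrow> \<beta> l') = (c = r l \<longrightarrow> \<beta> l)"
    proof (intro iffI ballI impI)
      fix l' assume "c = r l \<longrightarrow> \<beta> l" "l' \<in> L" "c = r l'"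
      then show "\<beta> l'" using uniq[of l'] by simp
    qed (use l in auto)
    then show "z \<beta> (fst c) (snd c) = (cell_base c = (c = r l \<longrightarrow> \<beta> l))" by (simp add: z_def)
  qed
  have f: "f0 x = H (\<lambda>l. block_value (T l) row_base (rows (Z l)) x = 1)" for x
  proof -
    define \<beta> where "\<beta> l = (block_value (T l) row_base (rows (Z l)) x = 1)" for l
    have "f0 x = f0 (\<lambda>i. g i (z \<beta> i))"
    proof (rule determined_by_block_values[OF fin(1) junta_f0, where L = L and R = "\<lambda>l. rows (Z l)" and T = T and b = row_base])
      show "rows (Z l) \<subseteq> I" if "l \<in> L" for l using types(1)[OF that] by blast
      show "\<exists>l\<in>L. i \<in> rows (Z l)" if i: "i \<in> I" for i
      proof -
        obtain j where "(i, j) \<in> cells" using dep2_g[OF i] i unfolding cells_def by blast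
        then obtain l where "l \<in> L" "(i, j) \<in> Z l" using ex by blast
        then show ?thesis using image_eqI[of i fst "(i, j)" "Z l"] by auto
      qed
      show "rows (Z l) \<inter> rows (Z l') = {}" if "l \<in> L" "l' \<in> L" "l \<noteq> l'" for l l'
        using disjoint_family_onD[OF disjoint_rows_cols(1)[OF bij] that] .
      show "f0 (flip i (flip k w)) = f0 w"
        if l: "l \<in> L" "T l" "i \<in> rows (Z l)" "k \<in> rows (Z l)" for l i k w
      proof -
        obtain c c' where c: "c \<in> Z l" "i = fst c" "c' \<in> Z l" "k = fst c'" using l(3,4) by auto
        show ?thesis unfolding c(2,4)
          by (rule xor_connected[OF block_connected[OF Zb[OF l(1)] c(1,3)]]) (use types(1)[OF l(1,3)] l(2) c in simp)
      qed
      show "f0 (flip i w) = f0 w"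
        if l: "l \<in> L" "\<not> T l" "i \<in> rows (Z l)" "k \<in> rows (Z l)" "i \<noteq> k" "w k \<noteq> row_base k" for l i k w
      proof -
        obtain c c' where c: "c \<in> Z l" "i = fst c" "c' \<in> Z l" "k = fst c'" using l(3,4) by auto
        have "\<not> xor_row i" "\<not> xor_row k" using types(1)[OF l(1,3)] types(1)[OF l(1,4)] l(2) by auto
        then have a: "\<not> xor_row (fst c)" "fst c \<noteq> fst c'" "w (fst c') \<noteq> row_value (fst c')"
          using l c by (auto simp: row_base_def)
        show ?thesis unfolding c(2)
          by (rule and_connected[OF block_connected[OF Zb[OF l(1)] c(1,3)]]) (rule a)+
      qed
      show "\<forall>l\<in>L. block_value (T l) row_base (rows (Z l)) x =
          block_value (T l) row_base (rows (Z l)) (\<lambda>i. g i (z \<beta> i))"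
      proof
        fix l assume l: "l \<in> L"
        have "block_value (T l) row_base (rows (Z l)) (\<lambda>i. g i (z \<beta> i)) =
          block_value (T l) cell_base (Sigma (rows (Z l)) (\<lambda>i. dep (g i))) (\<lambda>c. z \<beta> (fst c) (snd c))"
          by (rule block_value_rows) (use types(1)[OF l] in auto)
        also have "\<dots> = sg (\<beta> l)"
          unfolding block_row_Sigma[OF Zb[OF l], symmetric] by (rule cellval[OF l])
        finally show "block_value (T l) row_base (rows (Z l)) x =
            block_value (T l) row_base (rows (Z l)) (\<lambda>i. g i (z \<beta> i))"
          unfolding block_value_eq_iff[of "T l" row_base "rows (Z l)" x "T l" row_base "rows (Z l)" "\<lambda>i. g i (z \<beta> i)"]
          by (simp add: \<beta>_def)
      qed
    qed
    then show ?thesis unfolding H_def \<beta>_def .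
  qed
  have g: "g0 y = H (\<lambda>l. block_value (T l) dual.row_base (cols (Z l)) y = 1)" for y
  proof -
    define \<beta> where "\<beta> l = (block_value (T l) dual.row_base (cols (Z l)) y = 1)" for l
    have "g0 y = g0 (\<lambda>j. f j (\<lambda>i. z \<beta> i j))"
    proof (rule determined_by_block_values[OF fin(2) junta_g0, where L = L and R = "\<lambda>l. cols (Z l)" and T = T and b = dual.row_base])
      show "cols (Z l) \<subseteq> J" if "l \<in> L" for l using types(2)[OF that] by blast
      show "\<exists>l\<in>L. j \<in> cols (Z l)" if j: "j \<in> J" for j
      proof -
        obtain i where "(i, j) \<in> cells" using dep2_f[OF j] j unfolding mem_cells_dual by blast
        then obtain l where "l \<in> L" "(i, j) \<in> Z l" using ex by blast
        then show ?thesis using image_eqI[of j snd "(i, j)" "Z l"] by auto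
      qed
      show "cols (Z l) \<inter> cols (Z l') = {}" if "l \<in> L" "l' \<in> L" "l \<noteq> l'" for l l'
        using disjoint_family_onD[OF disjoint_rows_cols(2)[OF bij] that] .
      show "g0 (flip i (flip k w)) = g0 w"
        if l: "l \<in> L" "T l" "i \<in> cols (Z l)" "k \<in> cols (Z l)" for l i k w
      proof -
        obtain c c' where c: "c \<in> Z l" "i = fst (prod.swap c)" "c' \<in> Z l" "k = fst (prod.swap c')"
          using l(3,4) by auto
        show ?thesis unfolding c(2,4)
          by (rule dual.xor_connected[OF adjacent_dual[OF block_connected[OF Zb[OF l(1)] c(1,3)]]])
            (use types(2)[OF l(1,3)] l(2) c in simp)
      qed
      show "g0 (flip i w) = g0 w"
        if l: "l \<in> L" "\<not> T l" "i \<in> cols (Z l)" "k \<in> cols (Z l)" "i \<noteq> k" "w k \<noteq> dual.row_base k" for l i k w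
      proof -
        obtain c c' where c: "c \<in> Z l" "i = fst (prod.swap c)" "c' \<in> Z l" "k = fst (prod.swap c')"
          using l(3,4) by auto
        have "\<not> dual.xor_row i" "\<not> dual.xor_row k"
          using types(2)[OF l(1,3)] types(2)[OF l(1,4)] l(2) by auto
        then have a: "\<not> dual.xor_row (fst (prod.swap c))" "fst (prod.swap c) \<noteq> fst (prod.swap c')"
            "w (fst (prod.swap c')) \<noteq> dual.row_value (fst (prod.swap c'))"
          using l c by (auto simp: dual.row_base_def)
        show ?thesis unfolding c(2)
          by (rule dual.and_connected[OF adjacent_dual[OF block_connected[OF Zb[OF l(1)] c(1,3)]]]) (rule a)+
      qed
      show "\<forall>l\<in>L. block_value (T l) dual.row_base (cols (Z l)) y =
          block_value (T l) dual.row_base (cols (Z l)) (\<lambda>j. f j (\<lambda>i. z \<beta> i j))"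
      proof
        fix l assume l: "l \<in> L"
        have "block_value (T l) dual.row_base (cols (Z l)) (\<lambda>j. f j (\<lambda>i. z \<beta> i j)) = sg (\<beta> l)"
          using block_value_cols[OF Zb[OF l] root[OF l], of "z \<beta>"] cellval[OF l, of \<beta>] by (simp add: T_def)
        then show "block_value (T l) dual.row_base (cols (Z l)) y =
            block_value (T l) dual.row_base (cols (Z l)) (\<lambda>j. f j (\<lambda>i. z \<beta> i j))"
          unfolding block_value_eq_iff[of "T l" dual.row_base "cols (Z l)" y "T l" dual.row_base "cols (Z l)" "\<lambda>j. f j (\<lambda>i. z \<beta> i j)"]
          by (simp add: \<beta>_def)
      qed
    qed
    \<comment> \<open>The identity exchanges the composite through \<open>f0\<close> in
      \<open>H\<close> for the one through \<open>g0\<close>.\<close>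
    then show ?thesis unfolding H_def \<beta>_def commute .
  qed
  have "H \<beta> = H \<beta>'" if "\<forall>l\<in>L. \<beta> l = \<beta>' l" for \<beta> \<beta>'
  proof -
    have "z \<beta> = z \<beta>'" unfolding z_def using that by (intro ext) simp
    then show ?thesis by (simp add: H_def)
  qed
  then show ?thesis
    by (intro exI[of _ H] conjI allI impI f[unfolded T_def] g[unfolded T_def]) simp
qed

end

section \<open>Functions on the sign cube\<close>

text \<open>Restricting to \<open>S\<close> makes the result extensional, as membership in
  \<open>cube S\<close> requires.\<close>

definition emb :: "'i set \<Rightarrow> ('i \<Rightarrow> bool) \<Rightarrow> 'i \<Rightarrow> real" where
  "emb S x = (\<lambda>i\<in>S. sg (x i))"

definition signs :: "('i \<Rightarrow> real) \<Rightarrow> 'i \<Rightarrow> bool" where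
  "signs x = (\<lambda>i. x i = 1)"

definition bool_fun :: "'i set \<Rightarrow> (('i \<Rightarrow> real) \<Rightarrow> real) \<Rightarrow> ('i \<Rightarrow> bool) \<Rightarrow> bool" where
  "bool_fun S \<phi> x \<longleftrightarrow> \<phi> (emb S x) = 1"

lemma emb_in_cube: "emb S x \<in> cube S"
  unfolding emb_def cube_def using sg_in_pm1 by (intro restrict_PiE_iff[THEN iffD2]) blast

lemma sg_signs: "x \<in> cube S \<Longrightarrow> i \<in> S \<Longrightarrow> sg (signs x i) = x i"
  using cube_nth[of x S i] by (auto simp: signs_def)

lemma emb_signs:
  assumes "x \<in> cube S"
  shows "emb S (signs x) = x"
proof
  fix i
  show "emb S (signs x) i = x i"
  proof (cases "i \<in> S")
    case True
    then show ?thesis using sg_signs[OF assms] by (simp add: emb_def)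
  next
    case False
    then show ?thesis using assms by (auto simp: emb_def cube_def PiE_def extensional_def)
  qed
qed

lemma emb_cong:
  assumes "\<And>i. i \<in> S \<Longrightarrow> x i = y i"
  shows "emb S x = emb S y"
  unfolding emb_def by (rule restrict_ext) (simp add: assms)

lemma emb_flip: "i \<in> S \<Longrightarrow> emb S (flip i x) = (emb S x)(i := - emb S x i)"
  by (auto simp: emb_def flip_def restrict_def fun_eq_iff)

lemma sg_bool_fun:
  assumes "\<phi> \<in> cube S \<rightarrow> pm1"
  shows "sg (bool_fun S \<phi> x) = \<phi> (emb S x)"
proof -
  have "\<phi> (emb S x) \<in> pm1" using assms emb_in_cube by (rule funcset_mem)
  then show ?thesis by (auto simp: bool_fun_def sg_def)
qed

lemma junta_bool_fun: "junta S (bool_fun S \<phi>)"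
  unfolding junta_def
proof (intro allI impI)
  fix x y :: "'a \<Rightarrow> bool" assume "\<forall>i\<in>S. x i = y i"
  then have "emb S x = emb S y" by (intro emb_cong) simp
  then show "bool_fun S \<phi> x = bool_fun S \<phi> y" by (simp add: bool_fun_def)
qed

lemma dep_bool_fun:
  assumes \<phi>: "\<phi> \<in> cube S \<rightarrow> pm1"
  shows "dep (bool_fun S \<phi>) = Dep S \<phi>"
proof (intro set_eqI iffI)
  fix i assume "i \<in> dep (bool_fun S \<phi>)"
  then obtain x where x: "bool_fun S \<phi> (flip i x) \<noteq> bool_fun S \<phi> x" by (auto simp: dep_def)
  have i: "i \<in> S"
  proof (rule ccontr)
    assume ni: "i \<notin> S"
    have "bool_fun S \<phi> (flip i x) = bool_fun S \<phi> x"
    proof (rule juntaD[OF junta_bool_fun])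
      fix k assume "k \<in> S"
      then have "k \<noteq> i" using ni by auto
      then show "flip i x k = x k" by simp
    qed
    then show False using x by simp
  qed
  have "\<phi> ((emb S x)(i := - emb S x i)) \<noteq> \<phi> (emb S x)"
    using x unfolding bool_fun_def emb_flip[OF i] by auto
  then show "i \<in> Dep S \<phi>" unfolding Dep_def using i emb_in_cube[of S x] by blast
next
  fix i assume "i \<in> Dep S \<phi>"
  then obtain x where i: "i \<in> S" and x: "x \<in> cube S" "\<phi> (x(i := - x i)) \<noteq> \<phi> x" by (auto simp: Dep_def)
  have "\<phi> (emb S (flip i (signs x))) \<noteq> \<phi> (emb S (signs x))"
    unfolding emb_flip[OF i] emb_signs[OF x(1)] by (rule x(2))
  then have "bool_fun S \<phi> (flip i (signs x)) \<noteq> bool_fun S \<phi> (signs x)"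
    unfolding sg_bool_fun[OF \<phi>, symmetric] by simp
  then show "i \<in> dep (bool_fun S \<phi>)" unfolding dep_def by blast
qed

text \<open>If \<open>\<phi>\<close> ignores some \<open>i\<close> in \<open>A\<close>, negating
  coordinate \<open>i\<close> preserves \<open>\<phi>\<close> and negates the monomial of
  \<open>A\<close>; the Fourier sum is then its own negative.\<close>

lemma fourier_nonzero_subset_Dep:
  assumes S: "finite S" and A: "A \<subseteq> S" and nz: "fourier S \<phi> A \<noteq> 0"
  shows "A \<subseteq> Dep S \<phi>"
proof
  fix i assume i: "i \<in> A"
  show "i \<in> Dep S \<phi>"
  proof (rule ccontr)
    assume nd: "i \<notin> Dep S \<phi>"
    define \<tau> where "\<tau> = (\<lambda>x :: 'a \<Rightarrow> real. x(i := - x i))"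
    have iS: "i \<in> S" using i A by blast
    have inv: "\<tau> (\<tau> x) = x" for x by (simp add: \<tau>_def)
    have cube: "\<tau> x \<in> cube S" if "x \<in> cube S" for x
      using that iS unfolding cube_def \<tau>_def by (auto simp: PiE_iff extensional_def)
    have inv\<phi>: "\<phi> (\<tau> x) = \<phi> x" if "x \<in> cube S" for x
      using nd iS that unfolding Dep_def \<tau>_def by blast
    have finA: "finite A" using A S finite_subset by blast
    have prod: "(\<Prod>k\<in>A. \<tau> x k) = - (\<Prod>k\<in>A. x k)" for x
    proof -
      have "(\<Prod>k\<in>A - {i}. \<tau> x k) = (\<Prod>k\<in>A - {i}. x k)" by (rule prod.cong) (auto simp: \<tau>_def)
      then show ?thesis
        using prod.remove[OF finA i, of "\<tau> x"] prod.remove[OF finA i, of x] by (simp add: \<tau>_def)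
    qed
    have "(\<Sum>x\<in>cube S. \<phi> x * (\<Prod>k\<in>A. x k)) = (\<Sum>x\<in>cube S. \<phi> (\<tau> x) * (\<Prod>k\<in>A. \<tau> x k))"
      by (rule sum.reindex_bij_witness[of _ \<tau> \<tau>]) (auto simp: inv cube)
    also have "\<dots> = (\<Sum>x\<in>cube S. - (\<phi> x * (\<Prod>k\<in>A. x k)))"
      by (rule sum.cong) (simp_all add: inv\<phi> prod)
    finally have "(\<Sum>x\<in>cube S. \<phi> x * (\<Prod>k\<in>A. x k)) = 0" by (simp add: sum_negf)
    then have "fourier S \<phi> A = 0"
      using multilinear_expansion_coeff[OF S multilinear_expansion_fourier[OF S], of \<phi> A] by simp
    then show False using nz by simp
  qed
qed

lemma deg_ge_2_imp_Dep:
  assumes S: "finite S" and deg: "deg S \<phi> \<ge> 2"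
  shows "\<exists>k\<in>Dep S \<phi>. k \<noteq> i"
proof -
  let ?C = "insert 0 (card ` {A. A \<subseteq> S \<and> fourier S \<phi> A \<noteq> 0})"
  have "finite ?C" using S by simp
  \<comment> \<open>The maximum is attained; being at least 2, it comes from a set \<open>A\<close>
    with nonzero coefficient and not from the inserted 0.\<close>
  then have "deg S \<phi> \<in> ?C" unfolding deg_def by (intro Max_in) auto
  then obtain A where A: "A \<subseteq> S" "fourier S \<phi> A \<noteq> 0" "deg S \<phi> = card A" using deg by auto
  have "\<not> A \<subseteq> {i}"
  proof
    assume "A \<subseteq> {i}"
    then have "card A \<le> card {i}" by (intro card_mono) auto
    then show False using deg A(3) by simp
  qed
  then show ?thesis using fourier_nonzero_subset_Dep[OF S A(1,2)] by blast
qed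

text \<open>Each factor is the indicator of \<open>x i = b i\<close>.\<close>

lemma and_form:
  assumes "finite R"
  shows "(\<Prod>i\<in>R. (sg (b i) * sg (x i) + 1) / 2) = (if \<forall>i\<in>R. x i = b i then 1 else 0)"
proof (cases "\<forall>i\<in>R. x i = b i")
  case True
  have "(\<Prod>i\<in>R. (sg (b i) * sg (x i) + 1) / 2) = 1"
    by (rule prod.neutral) (use True in simp)
  then show ?thesis using True by simp
next
  case False
  then obtain i where i: "i \<in> R" "x i \<noteq> b i" by blast
  then have "(sg (b i) * sg (x i) + 1) / 2 = 0" by (cases "x i"; cases "b i") simp_all
  then have "(\<Prod>i\<in>R. (sg (b i) * sg (x i) + 1) / 2) = 0" using assms i(1) by (meson prod_zero)
  then show ?thesis using False by simp
qed

lemma block_value_and: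
  assumes "finite R"
  shows "block_value False b R x = 2 * (\<Prod>i\<in>R. (sg (b i) * sg (x i) + 1) / 2) - 1"
  unfolding and_form[OF assms] block_value_def by simp

text \<open>The first form is \<open>xor_form\<close>. For the second, twice the indicator of the
  conjunction minus 1 is a sign, and multiplying by the sign of the base value gives the
  row.\<close>

lemma (in commuting_pair) row_forms:
  assumes i: "i \<in> I"
  shows "xor_row i \<Longrightarrow> sg (g i y) = sg (row_base i) * (\<Prod>j\<in>dep (g i). sg (y j))"
    and "\<not> xor_row i \<Longrightarrow> sg (g i y) =
      2 * sg (row_base i) * (\<Prod>j\<in>dep (g i). (sg (canal i j) * sg (y j) + 1) / 2) - sg (row_base i)"
proof -
  have sub: "dep (g i) \<subseteq> J" using dep_g_imp_dep_f(1)[OF i] by blast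
  show "sg (g i y) = sg (row_base i) * (\<Prod>j\<in>dep (g i). sg (y j))" if x: "xor_row i"
    using xor_form[OF fin(2) junta_g[OF i] _ sub, of y] x by (simp add: row_base_def xor_row_def)
  assume nx: "\<not> xor_row i"
  have "finite (dep (g i))" using finite_subset[OF sub fin(2)] .
  then have "(\<Prod>j\<in>dep (g i). (sg (canal i j) * sg (y j) + 1) / 2) = (if g i y = row_value i then 1 else 0)"
    unfolding and_row[OF i nx] by (rule and_form)
  then show "sg (g i y) =
      2 * sg (row_base i) * (\<Prod>j\<in>dep (g i). (sg (canal i j) * sg (y j) + 1) / 2) - sg (row_base i)"
    using nx by (cases "g i y"; cases "row_value i") (simp_all add: row_base_def)
qed

section \<open>Return to the sign cube\<close>

theorem theorem3p14:
  fixes n m :: nat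
    and f g :: "nat \<Rightarrow> (nat \<Rightarrow> real) \<Rightarrow> real"
  assumes f_pm1: "\<And>j. j \<in> {0..m} \<Longrightarrow> f j \<in> cube {1..n} \<rightarrow> pm1"
    and g_pm1: "\<And>i. i \<in> {0..n} \<Longrightarrow> g i \<in> cube {1..m} \<rightarrow> pm1"
    and eq: "\<And>z. z \<in> cube ({1..n} \<times> {1..m}) \<Longrightarrow>
      f 0 (\<lambda>i\<in>{1..n}. g i (\<lambda>j\<in>{1..m}. z (i, j))) =
      g 0 (\<lambda>j\<in>{1..m}. f j (\<lambda>i\<in>{1..n}. z (i, j)))"
    and f_deg: "\<And>j. j \<in> {0..m} \<Longrightarrow> deg {1..n} (f j) \<ge> 2"
    and g_deg: "\<And>i. i \<in> {0..n} \<Longrightarrow> deg {1..m} (g i) \<ge> 2"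
    and f0_dep: "Dep {1..n} (f 0) = {1..n}"
    and g0_dep: "Dep {1..m} (g 0) = {1..m}"
  shows "\<exists>(Z0 :: (nat \<times> nat) set) (k :: nat) (Z :: nat \<Rightarrow> (nat \<times> nat) set)
      (h :: (nat \<Rightarrow> real) \<Rightarrow> real)
      (F :: nat \<Rightarrow> (nat \<Rightarrow> real) \<Rightarrow> real) (G :: nat \<Rightarrow> (nat \<Rightarrow> real) \<Rightarrow> real).
    Z0 \<subseteq> {1..n} \<times> {1..m} \<and>
    partition_on Z0 (Z ` {1..k}) \<and>
    disjoint_family_on (\<lambda>l. rows (Z l)) {1..k} \<and>
    disjoint_family_on (\<lambda>l. cols (Z l)) {1..k} \<and>
    h \<in> cube {1..k} \<rightarrow> pm1 \<and>
    (\<forall>l\<in>{1..k}. F l \<in> cube (rows (Z l)) \<rightarrow> pm1 \<and> G l \<in> cube (cols (Z l)) \<rightarrow> pm1) \<and>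
    (\<forall>x\<in>cube {1..n}. f 0 x = h (\<lambda>l\<in>{1..k}. F l (restrict x (rows (Z l))))) \<and>
    (\<forall>y\<in>cube {1..m}. g 0 y = h (\<lambda>l\<in>{1..k}. G l (restrict y (cols (Z l))))) \<and>
    (\<forall>l\<in>{1..k}.
      (\<exists>C A :: nat \<Rightarrow> real.
        (\<forall>i\<in>rows (Z l). C i \<in> pm1 \<and>
          (\<forall>y\<in>cube {1..m}. g i y = C i * (\<Prod>j'\<in>Dep {1..m} (g i). y j'))) \<and>
        (\<forall>j\<in>cols (Z l). A j \<in> pm1 \<and>
          (\<forall>x\<in>cube {1..n}. f j x = A j * (\<Prod>i'\<in>Dep {1..n} (f j). x i'))) \<and>
        (\<forall>x\<in>cube (rows (Z l)). F l x = (\<Prod>i\<in>rows (Z l). x i / C i)) \<and>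
        (\<forall>y\<in>cube (cols (Z l)). G l y = (\<Prod>j\<in>cols (Z l). y j / A j))) \<or>
      (\<exists>(D :: nat \<Rightarrow> real) (B :: nat \<Rightarrow> real) (\<kappa> :: nat \<Rightarrow> nat \<Rightarrow> real).
        (\<forall>i\<in>{1..n}. \<forall>j\<in>{1..m}. \<kappa> i j \<in> pm1) \<and>
        (\<forall>i\<in>rows (Z l). D i \<in> pm1 \<and>
          (\<forall>y\<in>cube {1..m}. g i y =
            2 * D i * (\<Prod>j'\<in>Dep {1..m} (g i). (\<kappa> i j' * y j' + 1) / 2) - D i)) \<and>
        (\<forall>j\<in>cols (Z l). B j \<in> pm1 \<and>
          (\<forall>x\<in>cube {1..n}. f j x =
            2 * B j * (\<Prod>i'\<in>Dep {1..n} (f j). (\<kappa> i' j * x i' + 1) / 2) - B j)) \<and>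
        (\<forall>x\<in>cube (rows (Z l)). F l x = 2 * (\<Prod>i\<in>rows (Z l). (D i * x i + 1) / 2) - 1) \<and>
        (\<forall>y\<in>cube (cols (Z l)). G l y = 2 * (\<Prod>j\<in>cols (Z l). (B j * y j + 1) / 2) - 1)))"
  (is "\<exists>Z0 k Z h F G. _ \<and> _ \<and> _ \<and> _ \<and> _ \<and> _ \<and> _ \<and> _ \<and>
    (\<forall>l\<in>{1..k}. ?Xor l Z F G \<or> ?And l Z F G)")
proof -
  define I J where IJ: "I = {1..n}" "J = {1..m}"
  define fb gb where fgb: "fb = (\<lambda>j. bool_fun I (f j))" "gb = (\<lambda>i. bool_fun J (g i))"
  \<comment> \<open>Index 0 carries the outer functions and lies outside \<open>I\<close> and
    \<open>J\<close>, whence \<open>insert 0\<close>.\<close>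
  have fpm: "f j \<in> cube I \<rightarrow> pm1" if "j \<in> insert 0 J" for j
    using f_pm1[of j] that by (auto simp: IJ)
  have gpm: "g i \<in> cube J \<rightarrow> pm1" if "i \<in> insert 0 I" for i
    using g_pm1[of i] that by (auto simp: IJ)
  have finIJ: "finite I" "finite J" by (simp_all add: IJ)
  have depf: "dep (fb j) = Dep I (f j)" if "j \<in> insert 0 J" for j
    unfolding fgb by (rule dep_bool_fun[OF fpm[OF that]])
  have depg: "dep (gb i) = Dep J (g i)" if "i \<in> insert 0 I" for i
    unfolding fgb by (rule dep_bool_fun[OF gpm[OF that]])
  have sgf: "sg (fb j x) = f j (emb I x)" if "j \<in> insert 0 J" for j x
    unfolding fgb by (rule sg_bool_fun[OF fpm[OF that]])
  have sgg: "sg (gb i y) = g i (emb J y)" if "i \<in> insert 0 I" for i y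
    unfolding fgb by (rule sg_bool_fun[OF gpm[OF that]])
  interpret P: commuting_pair "fb 0" "gb 0" fb gb I J
  proof
    show "fb 0 (\<lambda>i. gb i (z i)) = gb 0 (\<lambda>j. fb j (\<lambda>i. z i j))" for z
    proof -
      define w where "w = emb (I \<times> J) (\<lambda>c. z (fst c) (snd c))"
      have w: "w \<in> cube ({1..n} \<times> {1..m})" unfolding w_def IJ[symmetric] by (rule emb_in_cube)
      have row: "(\<lambda>j\<in>J. w (i, j)) = emb J (z i)" if "i \<in> I" for i
        unfolding w_def emb_def using that by (auto simp: restrict_def)
      have col: "(\<lambda>i\<in>I. w (i, j)) = emb I (\<lambda>i. z i j)" if "j \<in> J" for j
        unfolding w_def emb_def using that by (auto simp: restrict_def)
      have "emb I (\<lambda>i. gb i (z i)) = (\<lambda>i\<in>I. g i (\<lambda>j\<in>J. w (i, j)))"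
        unfolding emb_def[of I] by (rule restrict_ext) (simp add: sgg row)
      moreover have "emb J (\<lambda>j. fb j (\<lambda>i. z i j)) = (\<lambda>j\<in>J. f j (\<lambda>i\<in>I. w (i, j)))"
        unfolding emb_def[of J] by (rule restrict_ext) (simp add: sgf col)
      ultimately have "sg (fb 0 (\<lambda>i. gb i (z i))) = sg (gb 0 (\<lambda>j. fb j (\<lambda>i. z i j)))"
        using eq[OF w] by (simp add: sgf sgg IJ)
      then show ?thesis by (simp only: sg_simps)
    qed
    show "\<exists>i'\<in>dep (fb j). i' \<noteq> i" if "j \<in> J" for j i
      using deg_ge_2_imp_Dep[OF finIJ(1), of "f j" i] f_deg[of j] depf[of j] that by (simp add: IJ)
    show "\<exists>j'\<in>dep (gb i). j' \<noteq> j" if "i \<in> I" for i j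
      using deg_ge_2_imp_Dep[OF finIJ(2), of "g i" j] g_deg[of i] depg[of i] that by (simp add: IJ)
    show "dep (fb 0) = I" using depf[of 0] f0_dep by (simp add: IJ)
    show "dep (gb 0) = J" using depg[of 0] g0_dep by (simp add: IJ)
  qed (use finIJ junta_bool_fun in \<open>auto simp: fgb\<close>)
  interpret Q: commuting_pair "gb 0" "fb 0" gb fb J I
    by (rule P.swap)
  have "finite P.blocks"
    by (rule finite_subset[of _ "Pow P.cells"]) (use P.block_subset P.finite_cells in auto)
  then obtain Z where bij: "bij_betw Z {1..card P.blocks} P.blocks"
    using ex_bij_betw_nat_finite_1 by blast
  define k where "k = card P.blocks"
  \<comment> \<open>An arbitrary cell of each block, used as its root and to name its type.\<close>
  define r where "r l = (SOME c. c \<in> Z l)" for l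
  note bij = bij[folded k_def]
  have Zb: "Z l \<in> P.blocks" if "l \<in> {1..k}" for l using bij_betw_apply[OF bij that] .
  have root: "r l \<in> Z l" if "l \<in> {1..k}" for l
    unfolding r_def using P.block_nonempty[OF Zb[OF that]] by (simp add: some_in_eq)
  define T where "T l = P.xor_row (fst (r l))" for l
  have rows: "i \<in> I" "P.xor_row i = T l" if "l \<in> {1..k}" "i \<in> rows (Z l)" for l i
    using P.block_types(1)[OF Zb[OF that(1)] root[OF that(1)] that(2)] by (simp_all add: T_def)
  have cols: "j \<in> J" "Q.xor_row j = T l" if "l \<in> {1..k}" "j \<in> cols (Z l)" for l j
    using P.block_types(2)[OF Zb[OF that(1)] root[OF that(1)] that(2)] by (simp_all add: T_def)
  obtain H where H: "\<forall>\<beta> \<beta>'. (\<forall>l\<in>{1..k}. \<beta> l = \<beta>' l) \<longrightarrow> H \<beta> = H \<beta>'"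
    "\<forall>x. fb 0 x = H (\<lambda>l. block_value (T l) P.row_base (rows (Z l)) x = 1)"
    "\<forall>y. gb 0 y = H (\<lambda>l. block_value (T l) Q.row_base (cols (Z l)) y = 1)"
    using P.decomposition[OF bij root] unfolding T_def by blast
  define h where "h \<beta> = sg (H (signs \<beta>))" for \<beta>
  define F where "F l x = block_value (T l) P.row_base (rows (Z l)) (signs x)" for l x
  define G where "G l y = block_value (T l) Q.row_base (cols (Z l)) (signs y)" for l y
  have pm: "block_value t b R x \<in> pm1" for t and b :: "nat \<Rightarrow> bool" and R x
    using block_value_sg[of t b R x] sg_in_pm1 by auto
  have Frestrict: "F l (restrict x (rows (Z l))) = block_value (T l) P.row_base (rows (Z l)) (signs x)" for l x
    unfolding F_def by (rule block_value_cong) (simp add: signs_def)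
  have Grestrict: "G l (restrict y (cols (Z l))) = block_value (T l) Q.row_base (cols (Z l)) (signs y)" for l y
    unfolding G_def by (rule block_value_cong) (simp add: signs_def)
  have f0: "f 0 x = h (\<lambda>l\<in>{1..k}. F l (restrict x (rows (Z l))))" if x: "x \<in> cube {1..n}" for x
  proof -
    have "f 0 x = sg (fb 0 (signs x))"
      using sgf[of 0 "signs x"] emb_signs[of x I] x by (simp add: IJ)
    also have "\<dots> = sg (H (\<lambda>l. block_value (T l) P.row_base (rows (Z l)) (signs x) = 1))"
      using H(2) by simp
    \<comment> \<open>Outside \<open>{1..k}\<close> the decoded vector may differ from the vector of
      block values, but \<open>H\<close> reads only the indices in \<open>{1..k}\<close>.\<close>
    also have "H (\<lambda>l. block_value (T l) P.row_base (rows (Z l)) (signs x) = 1) =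
        H (signs (\<lambda>l\<in>{1..k}. F l (restrict x (rows (Z l)))))"
      by (rule H(1)[rule_format]) (simp add: signs_def[of "restrict _ _"] Frestrict)
    finally show ?thesis unfolding h_def .
  qed
  have g0: "g 0 y = h (\<lambda>l\<in>{1..k}. G l (restrict y (cols (Z l))))" if y: "y \<in> cube {1..m}" for y
  proof -
    have "g 0 y = sg (gb 0 (signs y))"
      using sgg[of 0 "signs y"] emb_signs[of y J] y by (simp add: IJ)
    also have "\<dots> = sg (H (\<lambda>l. block_value (T l) Q.row_base (cols (Z l)) (signs y) = 1))"
      using H(3) by simp
    also have "H (\<lambda>l. block_value (T l) Q.row_base (cols (Z l)) (signs y) = 1) =
        H (signs (\<lambda>l\<in>{1..k}. G l (restrict y (cols (Z l)))))"
      by (rule H(1)[rule_format]) (simp add: signs_def[of "restrict _ _"] Grestrict)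
    finally show ?thesis unfolding h_def .
  qed
  have part: "partition_on P.cells (Z ` {1..k})"
    unfolding bij_betw_imp_surj_on[OF bij] P.blocks_def by (rule partition_on_quotient[OF P.equiv_same_block])
  have giy: "g i y = sg (gb i (signs y))" if "i \<in> I" "y \<in> cube J" for i y
    using sgg[of i "signs y"] that by (simp add: emb_signs)
  have fjx: "f j x = sg (fb j (signs x))" if "j \<in> J" "x \<in> cube I" for j x
    using sgf[of j "signs x"] that by (simp add: emb_signs)
  have DepJ: "Dep J (g i) \<subseteq> J" for i unfolding Dep_def by blast
  have DepI: "Dep I (f j) \<subseteq> I" for j unfolding Dep_def by blast
  have finR: "finite (rows (Z l))" "finite (cols (Z l))" if "l \<in> {1..k}" for l
    using finite_subset[OF P.block_subset[OF Zb[OF that]] P.finite_cells] by auto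
  \<comment> \<open>The same constants serve both alternatives: \<open>C\<close> is used again as
    \<open>D\<close>, and \<open>A\<close> as \<open>B\<close>.\<close>
  define C where "C i = sg (P.row_base i)" for i
  define A where "A j = sg (Q.row_base j)" for j
  define \<kappa> where "\<kappa> i j = sg (P.canal i j)" for i j
  have CA: "C i \<in> pm1" "A j \<in> pm1" "\<kappa> i j \<in> pm1" for i j
    unfolding C_def A_def \<kappa>_def by (rule sg_in_pm1)+
  have gxor: "g i y = C i * (\<Prod>j'\<in>Dep J (g i). y j')" if "i \<in> I" "P.xor_row i" "y \<in> cube J" for i y
  proof -
    have "(\<Prod>j'\<in>Dep J (g i). y j') = (\<Prod>j'\<in>dep (gb i). sg (signs y j'))"
      using depg[of i] DepJ[of i] that(1) by (intro prod.cong) (auto simp: sg_signs[OF that(3)])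
    then show ?thesis
      unfolding giy[OF that(1,3)] C_def using P.row_forms(1)[OF that(1,2), of "signs y"] by simp
  qed
  have fxor: "f j x = A j * (\<Prod>i'\<in>Dep I (f j). x i')" if "j \<in> J" "Q.xor_row j" "x \<in> cube I" for j x
  proof -
    have "(\<Prod>i'\<in>Dep I (f j). x i') = (\<Prod>i'\<in>dep (fb j). sg (signs x i'))"
      using depf[of j] DepI[of j] that(1) by (intro prod.cong) (auto simp: sg_signs[OF that(3)])
    then show ?thesis
      unfolding fjx[OF that(1,3)] A_def using Q.row_forms(1)[OF that(1,2), of "signs x"] by simp
  qed
  have gand: "g i y = 2 * C i * (\<Prod>j'\<in>Dep J (g i). (\<kappa> i j' * y j' + 1) / 2) - C i"
    if "i \<in> I" "\<not> P.xor_row i" "y \<in> cube J" for i y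
  proof -
    have "(\<Prod>j'\<in>Dep J (g i). (\<kappa> i j' * y j' + 1) / 2) =
        (\<Prod>j'\<in>dep (gb i). (sg (P.canal i j') * sg (signs y j') + 1) / 2)"
      using depg[of i] DepJ[of i] that(1) by (intro prod.cong) (auto simp: sg_signs[OF that(3)] \<kappa>_def)
    then show ?thesis
      unfolding giy[OF that(1,3)] C_def using P.row_forms(2)[OF that(1,2), of "signs y"] by simp
  qed
  have fand: "f j x = 2 * A j * (\<Prod>i'\<in>Dep I (f j). (\<kappa> i' j * x i' + 1) / 2) - A j"
    if j: "j \<in> J" "\<not> Q.xor_row j" "x \<in> cube I" for j x
  proof -
    \<comment> \<open>\<open>\<kappa>\<close> is defined from the rows, whereas the form of
      \<open>f j\<close> uses the literals of the columns; on conjunction cells they agree.\<close>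
    have can: "P.canal i' j = Q.canal j i'" if i': "i' \<in> dep (fb j)" for i'
    proof -
      note d = P.dep_f_imp_dep_g[OF j(1) i']
      have "\<not> P.xor_row i'" using P.xor_row_iff_col[OF d] j(2) by simp
      then show ?thesis using P.canal_dual[OF d] by simp
    qed
    have "(\<Prod>i'\<in>Dep I (f j). (\<kappa> i' j * x i' + 1) / 2) =
        (\<Prod>i'\<in>dep (fb j). (sg (Q.canal j i') * sg (signs x i') + 1) / 2)"
    proof (rule prod.cong)
      show "Dep I (f j) = dep (fb j)" using depf[of j] j(1) by simp
      fix i' assume i': "i' \<in> dep (fb j)"
      then have "i' \<in> I" using depf[of j] DepI[of j] j(1) by auto
      then show "(\<kappa> i' j * x i' + 1) / 2 = (sg (Q.canal j i') * sg (signs x i') + 1) / 2"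
        using sg_signs[OF j(3)] can[OF i'] by (simp add: \<kappa>_def)
    qed
    then show ?thesis
      unfolding fjx[OF j(1,3)] A_def using Q.row_forms(2)[OF j(1,2), of "signs x"] by simp
  qed
  \<comment> \<open>Signs are their own inverses, so the divisions by \<open>C i\<close> and
    \<open>A j\<close> are multiplications.\<close>
  have inv: "a / sg b = a * sg b" for a b by (cases b) simp_all
  have Fxor: "F l x = (\<Prod>i\<in>rows (Z l). x i / C i)" if "T l" "x \<in> cube (rows (Z l))" for l x
    unfolding F_def block_value_def C_def inv using that(1) sg_signs[OF that(2)] by (simp cong: prod.cong)
  have Gxor: "G l y = (\<Prod>j\<in>cols (Z l). y j / A j)" if "T l" "y \<in> cube (cols (Z l))" for l y
    unfolding G_def block_value_def A_def inv using that(1) sg_signs[OF that(2)] by (simp cong: prod.cong)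
  have Fand: "F l x = 2 * (\<Prod>i\<in>rows (Z l). (C i * x i + 1) / 2) - 1"
    if "l \<in> {1..k}" "\<not> T l" "x \<in> cube (rows (Z l))" for l x
  proof -
    have "(\<Prod>i\<in>rows (Z l). (C i * x i + 1) / 2) = (\<Prod>i\<in>rows (Z l). (sg (P.row_base i) * sg (signs x i) + 1) / 2)"
      by (rule prod.cong[OF refl]) (simp add: C_def sg_signs[OF that(3)])
    then show ?thesis
      unfolding F_def using that(2) block_value_and[OF finR(1)[OF that(1)], of P.row_base "signs x"] by simp
  qed
  have Gand: "G l y = 2 * (\<Prod>j\<in>cols (Z l). (A j * y j + 1) / 2) - 1"
    if "l \<in> {1..k}" "\<not> T l" "y \<in> cube (cols (Z l))" for l y
  proof -
    have "(\<Prod>j\<in>cols (Z l). (A j * y j + 1) / 2) = (\<Prod>j\<in>cols (Z l). (sg (Q.row_base j) * sg (signs y j) + 1) / 2)"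
      by (rule prod.cong[OF refl]) (simp add: A_def sg_signs[OF that(3)])
    then show ?thesis
      unfolding G_def using that(2) block_value_and[OF finR(2)[OF that(1)], of Q.row_base "signs y"] by simp
  qed
  show ?thesis
  proof (rule exI[of _ P.cells], rule exI[of _ k], rule exI[of _ Z], rule exI[of _ h], rule exI[of _ F],
      rule exI[of _ G], intro conjI)
    show "P.cells \<subseteq> {1..n} \<times> {1..m}" using P.cells_subset unfolding IJ .
    show "partition_on P.cells (Z ` {1..k})" by (rule part)
    show "disjoint_family_on (\<lambda>l. rows (Z l)) {1..k}" by (rule P.disjoint_rows_cols(1)[OF bij])
    show "disjoint_family_on (\<lambda>l. cols (Z l)) {1..k}" by (rule P.disjoint_rows_cols(2)[OF bij])
    show "h \<in> cube {1..k} \<rightarrow> pm1" unfolding h_def using sg_in_pm1 by (intro funcsetI) blast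
    show "\<forall>l\<in>{1..k}. F l \<in> cube (rows (Z l)) \<rightarrow> pm1 \<and> G l \<in> cube (cols (Z l)) \<rightarrow> pm1"
      unfolding F_def G_def using pm by (intro ballI conjI funcsetI) blast+
    show "\<forall>x\<in>cube {1..n}. f 0 x = h (\<lambda>l\<in>{1..k}. F l (restrict x (rows (Z l))))"
      using f0 by blast
    show "\<forall>y\<in>cube {1..m}. g 0 y = h (\<lambda>l\<in>{1..k}. G l (restrict y (cols (Z l))))"
      using g0 by blast
    show "\<forall>l\<in>{1..k}. ?Xor l Z F G \<or> ?And l Z F G"
    proof
      fix l assume l: "l \<in> {1..k}"
      show "?Xor l Z F G \<or> ?And l Z F G"
      proof (cases "T l")
        case True
        have "?Xor l Z F G"
          unfolding IJ[symmetric]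
          by (rule exI[of _ C], rule exI[of _ A], intro conjI ballI CA gxor fxor Fxor Gxor)
            (use True rows[OF l] cols[OF l] in simp_all)
        then show ?thesis ..
      next
        case False
        have "?And l Z F G"
          unfolding IJ[symmetric]
          by (rule exI[of _ C], rule exI[of _ A], rule exI[of _ \<kappa>], intro conjI ballI CA gand fand Fand Gand)
            (use False l rows[OF l] cols[OF l] in simp_all)
        then show ?thesis ..
      qed
    qed
  qed
qed

end
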